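(* Suppose $\alpha>0$ is such that, for every nice measure $\mu$ on $\mathbb{R}^d$, there is a family $A$ of convex sets in $\mathbb{R}^d$ with the following properties: (i) every set in $A$ has $\mu$-measure at least $\alpha$; (ii) every hyperplane avoids at least one set of $A$; (iii) the sum of the $\mu$-measures of the sets in $A$ is not greater than $1$. Then $\alpha$ has to be exponentially small in terms of $d$. In other words, if $1\ge \alpha\cdot M_d(1,\alpha)$, then $$\frac{1}{\alpha}\ \ge\ \left[h_d\left(\frac{\pi}{4}\right)\right]^{-1}\ \approx\ C\cdot 2^{\frac d2}$$ for some constant $C>0$.
   Context: A nice measure on $\mathbb{R}^d$ is a measure, normalised to have total measure $1$, that has a continuous density function bounded away from $0$. A hyperplane in $\mathbb{R}^d$ avoids a set if it does not intersect the interior of the set. For a positive integer $k$ and $\alpha>0$, $M_d(k,\alpha)$ is the smallest positive integer such that for every nice measure $\mu$ on $\mathbb{R}^d$ there is a family of $M_d(k,\alpha)$ convex sets, all of $\mu$-measure at least $\alpha$, such that every hyperplane avoids at least $k$ of them. $S^d$ is the unit sphere in $\mathbb{R}^{d+1}$, and $h_d(t)$ is the measure, with respect to the usual (uniform) probability measure on $S^d$, of a spherical cap of $S^d$ with central angle $t$, i.e. of the set of points of $S^d$ at angular distance at most $t$ from a fixed point (the centre of the cap).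
   Formalization: Proved with 1/α ≥ [2h_d(π/4)]^{-1} (the printed bound fails for d=1: α=1/2, h_1(π/4)=1/4); ≈ C·2^{d/2} becomes 1/h_d(π/4) ~ C√d·2^{d/2} plus a lower bound C·2^{d/2}; a nice density is bounded away from 0 on bounded sets only. *)

theory Defs
  imports "HOL-Analysis.Analysis" "HOL-Library.Extended_Nat" "HOL-Library.Landau_Symbols"
begin

text \<open>
  No integrable function on the whole of \<open>\<real>\<^sup>d\<close> is globally bounded below by a positive constant, so
  ``bounded away from 0'' is read locally: on every bounded set.  The density is taken with respect
  to \<^term>\<open>lebesgue\<close> rather than \<^term>\<open>lborel\<close> because convex sets are Lebesgue measurable but need
  not be Borel.
\<close>

definition nice_measure :: "'a::euclidean_space measure \<Rightarrow> bool" where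
  "nice_measure \<mu> \<longleftrightarrow>
     emeasure \<mu> (space \<mu>) = 1 \<and>
     (\<exists>f :: 'a \<Rightarrow> real.
        continuous_on UNIV f \<and>
        (\<forall>S. bounded S \<longrightarrow> (\<exists>c>0. \<forall>x\<in>S. c \<le> f x)) \<and>
        \<mu> = density lebesgue (\<lambda>x. ennreal (f x)))"

definition hyperplane :: "'a::euclidean_space set \<Rightarrow> bool" where
  "hyperplane H \<longleftrightarrow> (\<exists>a b. a \<noteq> 0 \<and> H = {x. a \<bullet> x = b})"

definition avoids :: "'a::euclidean_space set \<Rightarrow> 'a set \<Rightarrow> bool" where
  "avoids H K \<longleftrightarrow> H \<inter> interior K = {}"

text \<open>
  Families are indexed, so repetitions count.  The value is \<open>\<infinity>\<close> if no number of sets suffices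
  (for instance if \<open>\<alpha> > 1\<close>).
\<close>

definition M_number :: "'a::euclidean_space itself \<Rightarrow> nat \<Rightarrow> real \<Rightarrow> enat" where
  "M_number _ k \<alpha> =
     Inf {enat m | m. 0 < m \<and>
       (\<forall>\<mu> :: 'a measure. nice_measure \<mu> \<longrightarrow>
          (\<exists>A :: nat \<Rightarrow> 'a set.
             (\<forall>i<m. convex (A i) \<and> \<alpha> \<le> measure \<mu> (A i)) \<and>
             (\<forall>H. hyperplane H \<longrightarrow> k \<le> card {i. i < m \<and> avoids H (A i)})))}"

text \<open>
  Since asymptotics in \<open>d\<close> are needed, \<open>\<real>\<^sup>d\<^sup>+\<^sup>1\<close> is represented by the extensional functions on
  \<open>{0, \<dots>, d}\<close>, with Lebesgue measure as a product measure.  The uniform probability measure on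
  \<open>S\<^sup>d\<close> is the image of the uniform distribution on the unit ball under radial projection
  (the origin, a null set, is sent to itself).
\<close>

definition l2norm :: "nat \<Rightarrow> (nat \<Rightarrow> real) \<Rightarrow> real" where
  "l2norm d x = sqrt (\<Sum>i\<le>d. (x i)\<^sup>2)"

definition unit_sphere :: "nat \<Rightarrow> (nat \<Rightarrow> real) set" where
  "unit_sphere d = {x \<in> {..d} \<rightarrow>\<^sub>E UNIV. l2norm d x = 1}"

definition sphere_measure :: "nat \<Rightarrow> (nat \<Rightarrow> real) measure" where
  "sphere_measure d =
     distr (uniform_measure (\<Pi>\<^sub>M i\<in>{..d}. lborel) {x \<in> {..d} \<rightarrow>\<^sub>E UNIV. l2norm d x \<le> 1})
       (\<Pi>\<^sub>M i\<in>{..d}. lborel) (\<lambda>x. \<lambda>i\<in>{..d}. x i / l2norm d x)"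

definition spherical_cap :: "nat \<Rightarrow> (nat \<Rightarrow> real) \<Rightarrow> real \<Rightarrow> (nat \<Rightarrow> real) set" where
  "spherical_cap d p t = {x \<in> unit_sphere d. arccos (\<Sum>i\<le>d. p i * x i) \<le> t}"

text \<open>
  By rotation invariance the centre is irrelevant; it is taken to be the first unit vector.
  Central projection identifies \<open>\<real>\<^sup>d\<close> with an open hemisphere of \<open>S\<^sup>d\<close>, which has measure 1/2; so
  the corresponding probability measure on \<open>\<real>\<^sup>d\<close> assigns \<open>2 * h d t\<close> to a cap of radius \<open>t\<close>
  contained in that hemisphere.
\<close>

definition h :: "nat \<Rightarrow> real \<Rightarrow> real" where
  "h d t = measure (sphere_measure d)
     (spherical_cap d (\<lambda>i\<in>{..d}. if i = 0 then 1 else 0) t)"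

end

theory Submission
  imports Defs "HOL-Real_Asymp.Real_Asymp"
begin

text \<open>
  Take for \<open>\<mu>\<close> the image of the uniform measure on an open hemisphere of \<open>S\<^sup>d\<close> under central
  projection to \<open>\<real>\<^sup>d\<close>.  A convex set becomes a convex cone in \<open>\<real>\<^sup>d\<^sup>+\<^sup>1\<close>, and the hyperplanes avoiding it
  have their normals in its polar cone or in the negative of that.  So the polar cones of a family
  as in the theorem, together with their negatives, cover the space.  On the other hand, if two
  cones \<open>A\<close>, \<open>B\<close> satisfy \<open>x \<bullet> y \<le> 0\<close> for all \<open>x \<in> A\<close>, \<open>y \<in> B\<close>, then they cannot both be larger than
  the circular cone with angle \<open>\<pi>/4\<close>.  Hence, if all sets of the family had measure above twice the
  measure of the cap, their polar cones would be too small for the covering.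

  The statement on pairs of cones is an instance of the isoperimetric inequality on the sphere.  It is
  proved by polarization: replacing \<open>A\<close> and \<open>B\<close> by their two-point rearrangements in opposite directions
  of a hyperplane keeps all the hypotheses.  A random reflection moves a definite proportion
  of \<open>A - C\<close> into \<open>C - A\<close>, so finitely many steps make \<open>A\<close> fill the circular cone \<open>C\<close> up to an
  arbitrarily small error, and then \<open>B\<close> has no room outside of \<open>- C\<close>.
\<close>

subsection \<open>Polarization of cones\<close>

text \<open>Not restricted to unit vectors \<open>u\<close>, so that reflections can be averaged
  over a ball; \<open>reflect 0\<close> is the identity.\<close>

definition reflect :: "'a::euclidean_space \<Rightarrow> 'a \<Rightarrow> 'a" where
  "reflect u x = x - (2 * (u \<bullet> x) / (u \<bullet> u)) *\<^sub>R u"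

lemma reflect_scaleR: "reflect u (c *\<^sub>R x) = c *\<^sub>R reflect u x"
  by (simp add: reflect_def algebra_simps)

lemma reflect_uminus: "reflect (-u) x = reflect u x"
  by (simp add: reflect_def)

lemma inner_reflect_self: "u \<bullet> reflect u x = - (u \<bullet> x)"
  by (cases "u = 0") (simp_all add: reflect_def inner_diff_right)

lemma reflect_reflect [simp]: "reflect u (reflect u x) = x"
  using inner_reflect_self[of u x] by (simp add: reflect_def[of u "reflect u x"]) (simp add: reflect_def)

lemma inner_reflect_left: "reflect u x \<bullet> y = x \<bullet> reflect u y"
  by (simp add: reflect_def inner_diff_left inner_diff_right inner_commute mult.commute)

lemma inner_reflect_reflect: "reflect u x \<bullet> reflect u y = x \<bullet> y"
  by (simp add: inner_reflect_left)

lemma orthogonal_transformation_reflect: "orthogonal_transformation (reflect u)"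
  unfolding orthogonal_transformation_def
  by (auto intro!: linearI simp: reflect_scaleR inner_reflect_reflect)
     (simp add: reflect_def inner_add_right algebra_simps add_divide_distrib)

lemma norm_reflect [simp]: "norm (reflect u x) = norm x"
  by (simp add: norm_eq_sqrt_inner inner_reflect_reflect)

lemma reflect_image: "reflect u ` S = {x. reflect u x \<in> S}"
  by (auto simp: image_iff) (metis reflect_reflect)

lemma inner_reflect_eq: "x \<bullet> reflect u y = x \<bullet> y - 2 * (u \<bullet> x) * (u \<bullet> y) / (u \<bullet> u)"
  by (simp add: reflect_def inner_diff_right inner_commute)

lemma borel_measurable_reflect [measurable]:
  "(\<lambda>(u, x). reflect u x) \<in> borel_measurable (borel \<Otimes>\<^sub>M borel)"
  unfolding reflect_def by (simp add: split_beta) measurable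

lemma borel_measurable_reflect' [measurable]: "reflect u \<in> borel_measurable borel"
  unfolding reflect_def by measurable

section \<open>Positive cones and their volume\<close>

definition pos_cone :: "'a::real_vector set \<Rightarrow> bool" where
  "pos_cone S \<longleftrightarrow> (\<forall>x\<in>S. \<forall>c>0. c *\<^sub>R x \<in> S)"

lemma pos_coneD: "pos_cone S \<Longrightarrow> x \<in> S \<Longrightarrow> c > 0 \<Longrightarrow> c *\<^sub>R x \<in> S"
  by (auto simp: pos_cone_def)

lemma pos_cone_iff:
  assumes "pos_cone S" "c > 0" shows "c *\<^sub>R x \<in> S \<longleftrightarrow> x \<in> S"
  using pos_coneD[OF assms(1), of x c] pos_coneD[OF assms(1), of "c *\<^sub>R x" "inverse c"] assms(2) by auto

lemma pos_cone_Diff: "pos_cone S \<Longrightarrow> pos_cone T \<Longrightarrow> pos_cone (S - T)"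
  by (auto simp: pos_cone_def pos_cone_iff)

text \<open>Cutting a cone off at the unit ball makes its size finite; for positive cones this
  measures the solid angle up to a constant factor.\<close>

definition vol :: "'a::euclidean_space set \<Rightarrow> real" where
  "vol S = measure lebesgue (S \<inter> cball 0 1)"

lemma lmeasurable_Int_cball: "S \<in> sets borel \<Longrightarrow> S \<inter> cball 0 1 \<in> lmeasurable"
  by (intro bounded_set_imp_lmeasurable) (auto intro: bounded_subset[OF bounded_cball] sets_completionI_sets)

lemma vol_mono: "S \<subseteq> T \<Longrightarrow> S \<in> sets borel \<Longrightarrow> T \<in> sets borel \<Longrightarrow> vol S \<le> vol T"
  unfolding vol_def by (intro measure_mono_fmeasurable)
   (auto simp: lmeasurable_Int_cball intro: fmeasurableD)

lemma vol_nonneg [simp]: "0 \<le> vol S"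
  by (simp add: vol_def)

lemma vol_Un: "S \<inter> T = {} \<Longrightarrow> S \<in> sets borel \<Longrightarrow> T \<in> sets borel \<Longrightarrow> vol (S \<union> T) = vol S + vol T"
  unfolding vol_def Int_Un_distrib2
  by (intro measure_Un_AE) (auto simp: lmeasurable_Int_cball intro: fmeasurableD)

lemma vol_split:
  assumes "S \<in> sets borel" "T \<in> sets borel"
  shows "vol S = vol (S \<inter> T) + vol (S - T)"
  using vol_Un[of "S \<inter> T" "S - T"] assms by (auto simp: Int_Diff_Un)

lemma vol_reflect_image:
  fixes S :: "(real ^ 'm::{finite,wellorder}) set"
  assumes "S \<in> sets borel"
  shows "vol (reflect u ` S) = vol S"
proof -
  have "reflect u ` S \<inter> cball 0 1 = reflect u ` (S \<inter> cball 0 1)"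
    by auto
  then show ?thesis
    unfolding vol_def
    by (simp add: measure_orthogonal_image[OF orthogonal_transformation_reflect lmeasurable_Int_cball[OF assms]])
qed

lemma borel_reflect_image:
  "S \<in> sets borel \<Longrightarrow> reflect u ` S \<in> sets borel"
  using measurable_sets_borel[OF borel_measurable_reflect', of S u]
  unfolding reflect_image vimage_def by simp

text \<open>This is the two-point rearrangement: of a mirror pair with exactly one point in
  \<open>S\<close>, the point on the side \<open>0 \<le> u \<bullet> x\<close> is kept, whichever of
  the two was in \<open>S\<close>.\<close>

definition polarize :: "'a::euclidean_space \<Rightarrow> 'a set \<Rightarrow> 'a set" where
  "polarize u S = {x. (x \<in> S \<and> reflect u x \<in> S) \<or> (0 \<le> u \<bullet> x \<and> (x \<in> S \<or> reflect u x \<in> S))}"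

lemma borel_polarize:
  assumes [measurable]: "S \<in> sets borel"
  shows "polarize u S \<in> sets borel"
  unfolding polarize_def by measurable

lemma pos_cone_polarize: "pos_cone S \<Longrightarrow> pos_cone (polarize u S)"
  by (subst pos_cone_def) (auto simp: polarize_def reflect_scaleR pos_cone_iff zero_le_mult_iff)

text \<open>A point of \<open>S\<close> is lost only if \<open>u \<bullet> x < 0\<close> and its
  mirror image is not in \<open>S\<close>; that image is then gained. Since reflections preserve
  volume, the gain makes up for the loss.\<close>

lemma vol_polarize_ge:
  fixes S :: "(real ^ 'm::{finite,wellorder}) set"
  assumes S: "S \<in> sets borel"
  shows "vol S \<le> vol (polarize u S)"
proof -
  note P = borel_polarize[OF S, of u]
  have "vol S = vol (S \<inter> polarize u S) + vol (S - polarize u S)"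
    using S P by (rule vol_split)
  also have "vol (S - polarize u S) = vol (reflect u ` (S - polarize u S))"
    using S P by (simp add: vol_reflect_image)
  also have "vol (S \<inter> polarize u S) + \<dots> = vol (S \<inter> polarize u S \<union> reflect u ` (S - polarize u S))"
    using S P by (subst vol_Un) (auto simp: reflect_image polarize_def inner_reflect_self intro: borel_reflect_image)
  also have "\<dots> \<le> vol (polarize u S)"
    using S P by (intro vol_mono) (auto simp: reflect_image polarize_def inner_reflect_self intro!: borel_reflect_image)
  finally show ?thesis .
qed

text \<open>If \<open>A\<close> contains both \<open>x\<close> and its image, or \<open>B\<close>
  both \<open>y\<close> and its image, then a matching choice of images gives a pair in
  \<open>A\<close> and \<open>B\<close> with the same inner product. Otherwise \<open>x\<close> and
  \<open>y\<close> lie on opposite sides of the mirror, and reflecting just one of them can only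
  increase the inner product.\<close>

lemma polarize_inner_nonpos:
  assumes AB: "\<And>x y. x \<in> A \<Longrightarrow> y \<in> B \<Longrightarrow> x \<bullet> y \<le> 0"
    and x: "x \<in> polarize u A" and y: "y \<in> polarize (-u) B"
  shows "x \<bullet> y \<le> 0"
proof -
  let ?x = "reflect u x" and ?y = "reflect u y"
  have eq: "?x \<bullet> ?y = x \<bullet> y" "?x \<bullet> y = x \<bullet> ?y"
    by (auto simp: inner_reflect_reflect inner_reflect_left)
  have le: "x \<bullet> y \<le> x \<bullet> ?y" if "0 \<le> u \<bullet> x" "u \<bullet> y \<le> 0"
    using that by (simp add: inner_reflect_eq mult_nonneg_nonpos divide_nonpos_nonneg)
  show ?thesis
    using x y AB[of x y] AB[of ?x y] AB[of x ?y] AB[of ?x ?y] le eq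
    unfolding polarize_def by (auto simp: reflect_uminus)
qed

text \<open>The hypothesis \<open>refl\<close> says that \<open>C\<close> itself is stable under
  this polarization. Three disjoint parts of \<open>C - A\<close> are exhibited: the images of the
  points of \<open>C \<inter> A\<close> that get lost, the points that remain missing, and the
  images of the second set on the left, which are missing from \<open>A\<close> but get
  filled.\<close>

lemma vol_Diff_polarize:
  fixes A :: "(real ^ 'm::{finite,wellorder}) set"
  assumes A: "A \<in> sets borel" and C: "C \<in> sets borel"
    and refl: "\<And>x. x \<in> C \<Longrightarrow> u \<bullet> x \<le> 0 \<Longrightarrow> reflect u x \<in> C"
  shows "vol (C - polarize u A) + vol {x \<in> A - C. reflect u x \<in> C - A} \<le> vol (C - A)"
proof -
  let ?P = "polarize u A" and ?R = "reflect u"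
  note P = borel_polarize[OF A, of u]
  define W where "W = {x \<in> A - C. ?R x \<in> C - A}"
  have [measurable]: "A \<in> sets borel" "C \<in> sets borel" by fact+
  have W: "W \<in> sets borel" unfolding W_def by measurable
  have nonneg: "0 < u \<bullet> ?R x" if "x \<in> W" for x
  proof (rule ccontr)
    assume "\<not> 0 < u \<bullet> ?R x"
    then show False using that refl[of "?R x"] by (simp add: W_def)
  qed
  have refl': "x \<in> C" if "?R x \<in> C" "0 \<le> u \<bullet> x" for x
    using refl[of "?R x"] that by (simp add: inner_reflect_self)
  have "vol (C - ?P) = vol ((C - ?P) \<inter> A) + vol (C - ?P - A)"
    using A C P by (intro vol_split) auto
  also have "vol ((C - ?P) \<inter> A) = vol (?R ` ((C - ?P) \<inter> A))"
    using A C P by (simp add: vol_reflect_image)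
  also have "vol (?R ` ((C - ?P) \<inter> A)) + vol (C - ?P - A)
     = vol (?R ` ((C - ?P) \<inter> A) \<union> (C - ?P - A))"
    using A C P refl by (subst vol_Un) (auto simp: reflect_image polarize_def inner_reflect_self intro!: borel_reflect_image)
  finally have "vol (C - ?P) + vol W = vol (?R ` ((C - ?P) \<inter> A) \<union> (C - ?P - A)) + vol (?R ` W)"
    using W by (simp add: vol_reflect_image)
  also have "\<dots> = vol (?R ` ((C - ?P) \<inter> A) \<union> (C - ?P - A) \<union> ?R ` W)"
  proof (subst vol_Un[of _ "?R ` W"])
    show "(?R ` ((C - ?P) \<inter> A) \<union> (C - ?P - A)) \<inter> ?R ` W = {}"
      using nonneg by (force simp: reflect_image polarize_def W_def)
  qed (use A C P W in \<open>auto intro!: borel_reflect_image sets.Un\<close>)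
  also have "\<dots> \<le> vol (C - A)"
  proof (intro vol_mono)
    show "?R ` ((C - ?P) \<inter> A) \<union> (C - ?P - A) \<union> ?R ` W \<subseteq> C - A"
      using refl refl' by (auto simp: reflect_image polarize_def inner_reflect_self W_def)
  qed (use A C P W in \<open>auto intro!: borel_reflect_image sets.Un\<close>)
  finally show ?thesis by (simp add: W_def)
qed

section \<open>How much volume a random reflection moves\<close>

lemma abs_det_le:
  fixes A :: "real ^ 'm ^ 'm"
  assumes "\<And>i j. \<bar>A $ i $ j\<bar> \<le> M"
  shows "\<bar>det A\<bar> \<le> fact CARD('m) * M ^ CARD('m)"
proof -
  let ?S = "{p. p permutes (UNIV :: 'm set)}"
  have "\<bar>det A\<bar> \<le> (\<Sum>p\<in>?S. \<bar>of_int (sign p) * (\<Prod>i\<in>UNIV. A $ i $ p i)\<bar>)"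
    unfolding det_def by (rule sum_abs)
  also have "\<dots> \<le> (\<Sum>p\<in>?S. M ^ CARD('m))"
  proof (intro sum_mono)
    fix p :: "'m \<Rightarrow> 'm"
    have "(\<Prod>i\<in>UNIV. \<bar>A $ i $ p i\<bar>) \<le> (\<Prod>i\<in>(UNIV::'m set). M)"
      using assms by (intro prod_mono) auto
    then show "\<bar>of_int (sign p) * (\<Prod>i\<in>UNIV. A $ i $ p i)\<bar> \<le> M ^ CARD('m)"
      by (simp add: abs_mult abs_prod sign_def)
  qed
  also have "\<dots> = fact CARD('m) * M ^ CARD('m)"
    by (simp add: card_permutations[of UNIV "CARD('m)"])
  finally show ?thesis .
qed

text \<open>
  Here \<open>\<phi> u = (u \<bullet> u) *\<^sub>R reflect u x\<close>.  Since only the direction matters for cones, this polynomial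
  map, with bounded derivative on the ball, can stand in for \<open>\<lambda>u. reflect u x\<close>.
\<close>

lemma measure_reflection_orbit_le:
  fixes x :: "real ^ 'm::{finite,wellorder}"
  assumes x: "norm x = 1" and U: "U \<in> lmeasurable" "U \<subseteq> cball 0 1"
  defines "\<phi> \<equiv> \<lambda>u. (u \<bullet> u) *\<^sub>R x - (2 * (u \<bullet> x)) *\<^sub>R u"
  shows "\<phi> ` U \<in> lmeasurable" "measure lebesgue (\<phi> ` U) \<le> fact CARD('m) * 6 ^ CARD('m) * measure lebesgue U"
proof -
  define D where "D = (\<lambda>u v. (2 * (u \<bullet> v)) *\<^sub>R x - (2 * (v \<bullet> x)) *\<^sub>R u - (2 * (u \<bullet> x)) *\<^sub>R v)"
  have deriv: "(\<phi> has_derivative D u) (at u within U)" for u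
    unfolding \<phi>_def D_def
    by (auto intro!: derivative_eq_intros simp: fun_eq_iff algebra_simps inner_commute)
  \<comment> \<open>The derivative has three terms, each of norm at most 2 on the unit ball, hence
    the 6.\<close>
  have "\<bar>matrix (D u) $ i $ j\<bar> \<le> 6" if "u \<in> U" for u i j
  proof -
    have u: "norm u \<le> 1" using that U by auto
    let ?a = "axis j 1 :: real ^ 'm::_"
    have *: "\<bar>a \<bullet> b\<bar> \<le> 1" if "norm a \<le> 1" "norm b \<le> 1" for a b :: "real ^ 'm::_"
      using Cauchy_Schwarz_ineq2[of a b] mult_mono[OF that] by simp
    have **: "norm ((2 * (a \<bullet> b)) *\<^sub>R c) \<le> 2"
      if "norm a \<le> 1" "norm b \<le> 1" "norm c \<le> 1" for a b c :: "real ^ 'm::_"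
      using mult_mono[OF *[OF that(1,2)] that(3)] by (simp add: abs_mult)
    have "\<bar>matrix (D u) $ i $ j\<bar> \<le> norm (D u ?a)"
      by (simp add: matrix_def component_le_norm_cart)
    also have "\<dots> \<le> norm ((2 * (u \<bullet> ?a)) *\<^sub>R x) + norm ((2 * (?a \<bullet> x)) *\<^sub>R u) + norm ((2 * (u \<bullet> x)) *\<^sub>R ?a)"
      unfolding D_def by (meson add_mono norm_triangle_ineq4 order.refl order_trans)
    also have "\<dots> \<le> 2 + 2 + 2"
      using u x by (intro add_mono **) (auto simp: norm_axis_1)
    finally show ?thesis by simp
  qed
  then have bound: "\<bar>det (matrix (D u))\<bar> \<le> fact CARD('m) * 6 ^ CARD('m)" if "u \<in> U" for u
    using that by (intro abs_det_le)
  obtain a where a: "cball 0 1 \<subseteq> cbox (-a) (a :: real ^ 'm::_)"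
    using bounded_subset_cbox_symmetric[OF bounded_cball] by blast
  have "continuous_on (cbox (-a) a) (\<lambda>u. \<bar>det (matrix (D u))\<bar>)"
    unfolding det_def matrix_def D_def by (auto intro!: continuous_intros)
  then have "(\<lambda>u. \<bar>det (matrix (D u))\<bar>) absolutely_integrable_on cbox (-a) a"
    by (rule absolutely_integrable_continuous)
  then have "(\<lambda>u. \<bar>det (matrix (D u))\<bar>) absolutely_integrable_on U"
    by (rule set_integrable_subset) (use U a in \<open>blast intro: fmeasurableD\<close>)+
  then have int: "(\<lambda>u. \<bar>det (matrix (D u))\<bar>) integrable_on U"
    using absolutely_integrable_on_def by blast
  show "\<phi> ` U \<in> lmeasurable" "measure lebesgue (\<phi> ` U) \<le> fact CARD('m) * 6 ^ CARD('m) * measure lebesgue U"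
    using measurable_bounded_differentiable_image[OF U(1) deriv int bound]
      measure_bounded_differentiable_image[OF U(1) deriv int bound] by auto
qed

lemma reflect_scale: "c \<noteq> 0 \<Longrightarrow> reflect (c *\<^sub>R u) x = reflect u x"
  by (simp add: reflect_def)

lemma reflect_diff:
  assumes "norm x = norm y" "x \<noteq> y"
  shows "reflect (x - y) x = y"
proof -
  have "x \<bullet> x = y \<bullet> y" using assms(1) by (simp add: norm_eq)
  then have "(x - y) \<bullet> (x - y) = 2 * ((x - y) \<bullet> x)"
    by (simp add: algebra_simps inner_commute)
  moreover have "(x - y) \<bullet> (x - y) \<noteq> 0" using assms(2) by simp
  ultimately show ?thesis by (simp add: reflect_def)
qed

text \<open>Any unit vector \<open>w\<close> other than \<open>sgn x\<close> is its image under the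
  reflection along \<open>sgn x - w\<close>. So the polynomial orbit map of
  \<open>measure_reflection_orbit_le\<close> sends the admissible \<open>u\<close> onto the nonzero
  part of \<open>Q\<close> in the ball, and it expands volume by a bounded factor only.\<close>

lemma vol_le_vol_reflections:
  fixes x :: "real ^ 'm::{finite,wellorder}"
  assumes "x \<noteq> 0" and [measurable]: "Q \<in> sets borel" and Q: "pos_cone Q" and "x \<notin> Q"
  shows "vol Q \<le> fact CARD('m) * 6 ^ CARD('m) * vol {u. reflect u x \<in> Q}"
proof -
  define z where "z = sgn x"
  have z: "norm z = 1" "x = norm x *\<^sub>R z"
    using \<open>x \<noteq> 0\<close> by (auto simp: z_def norm_sgn) (simp add: sgn_div_norm)
  define \<phi> where "\<phi> = (\<lambda>u. (u \<bullet> u) *\<^sub>R z - (2 * (u \<bullet> z)) *\<^sub>R u)"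
  define U where "U = {u. reflect u x \<in> Q} \<inter> cball 0 1"
  have U: "U \<in> lmeasurable"
    unfolding U_def by (intro lmeasurable_Int_cball) measurable
  have sub: "Q \<inter> cball 0 1 \<subseteq> insert 0 (\<phi> ` U)"
  proof
    fix y assume y: "y \<in> Q \<inter> cball 0 1"
    show "y \<in> insert 0 (\<phi> ` U)"
    proof (cases "y = 0")
      case False
      define w where "w = sgn y"
      have w: "norm w = 1" "y = norm y *\<^sub>R w"
        using False by (auto simp: w_def norm_sgn) (simp add: sgn_div_norm)
      have "w \<in> Q"
        using pos_coneD[OF Q, of y "inverse (norm y)"] y False by (simp add: w_def sgn_div_norm)
      have "z \<noteq> w"
        using pos_coneD[OF Q \<open>w \<in> Q\<close>, of "norm x"] \<open>x \<noteq> 0\<close> \<open>x \<notin> Q\<close> z by auto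
      \<comment> \<open>The length is chosen so that \<open>u \<bullet> u = norm y\<close>: then
        \<open>\<phi> u\<close> is \<open>y\<close> itself and not only a multiple, and
        \<open>u\<close> stays in the unit ball.\<close>
      define u where "u = (sqrt (norm y) / norm (z - w)) *\<^sub>R (z - w)"
      have uu: "u \<bullet> u = norm y"
        using \<open>z \<noteq> w\<close> by (simp add: u_def dot_square_norm power2_eq_square)
      have r: "reflect u z = w"
        unfolding u_def using \<open>z \<noteq> w\<close> False z w by (subst reflect_scale) (auto intro!: reflect_diff)
      have "reflect u x \<in> Q"
        using pos_coneD[OF Q \<open>w \<in> Q\<close>, of "norm x"] \<open>x \<noteq> 0\<close> r reflect_scaleR[of u "norm x" z] z by simp
      moreover have "norm u \<le> 1"
        using uu y by (simp add: norm_eq_sqrt_inner)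
      moreover have "\<phi> u = (u \<bullet> u) *\<^sub>R reflect u z"
        using uu False by (simp add: \<phi>_def reflect_def algebra_simps)
      then have "\<phi> u = y" using r w(2) uu by simp
      ultimately show ?thesis by (auto simp: U_def)
    qed simp
  qed
  have T: "\<phi> ` U \<in> lmeasurable"
    using measure_reflection_orbit_le(1)[OF z(1) U] by (auto simp: \<phi>_def U_def)
  then have T': "insert 0 (\<phi> ` U) \<in> lmeasurable"
    by (subst insert_is_Un) (rule fmeasurable.Un[OF negligible_imp_measurable[OF negligible_sing]])
  have "vol Q \<le> measure lebesgue (insert 0 (\<phi> ` U))"
    unfolding vol_def using T' sub
    by (intro measure_mono_fmeasurable) (auto simp: lmeasurable_Int_cball intro: fmeasurableD)
  also have "\<dots> = measure lebesgue (\<phi> ` U)"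
    by (rule measure_negligible_symdiff[OF T]) (rule negligible_subset[OF negligible_sing[of 0]], auto)
  also have "\<dots> \<le> fact CARD('m) * 6 ^ CARD('m) * measure lebesgue U"
    using measure_reflection_orbit_le(2)[OF z(1) U] by (auto simp: \<phi>_def U_def)
  finally show ?thesis by (simp add: U_def vol_def)
qed

lemma emeasure_Int_cball:
  assumes "S \<in> sets borel"
  shows "emeasure lborel (S \<inter> cball 0 1) = ennreal (vol S)"
proof -
  have "emeasure lborel (S \<inter> cball 0 1) = emeasure lebesgue (S \<inter> cball 0 1)"
    using assms by (simp add: emeasure_completion)
  also have "\<dots> = ennreal (vol S)"
    unfolding vol_def using lmeasurable_Int_cball[OF assms]
    by (intro emeasure_eq_measure2) (auto simp: fmeasurable_def)
  finally show ?thesis .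
qed

lemma vol_UNIV_pos: "0 < vol (UNIV :: 'a::euclidean_space set)"
  unfolding vol_def by (simp add: content_cball_pos)

text \<open>This is an averaging argument. Every nonzero \<open>x\<close> in \<open>P\<close> is
  sent into \<open>Q\<close> by a set of \<open>u\<close> of volume at least
  \<open>vol Q / K\<close>; by Fubini, some \<open>u\<close> in the unit ball achieves at least the
  average over the ball.\<close>

lemma exists_reflection_overlap:
  fixes P Q :: "(real ^ 'm::{finite,wellorder}) set"
  assumes [measurable]: "P \<in> sets borel" "Q \<in> sets borel" and Q: "pos_cone Q" and disj: "P \<inter> Q = {}"
  defines "K \<equiv> fact CARD('m) * 6 ^ CARD('m)"
  shows "\<exists>u. vol P * vol Q / (2 * K * vol (UNIV :: (real ^ 'm::_) set)) \<le> vol {x \<in> P. reflect u x \<in> Q}"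
proof (cases "vol P * vol Q = 0")
  case False
  let ?V = "vol (UNIV :: (real ^ 'm::_) set)"
  have pos: "0 < vol P" "0 < vol Q" "0 < K" "0 < ?V"
    using False vol_nonneg[of P] vol_nonneg[of Q] vol_UNIV_pos by (auto simp: K_def simp del: vol_nonneg)
  \<comment> \<open>Half of the average: the slack turns the non-strict bounds from Fubini into a
    contradiction.\<close>
  define s where "s = vol P * vol Q / (2 * K * ?V)"
  show ?thesis
  proof (rule ccontr)
    assume "\<not> ?thesis"
    then have less: "vol {x \<in> P. reflect u x \<in> Q} \<le> s" for u
      unfolding s_def by (meson less_imp_le not_le)
    define S where "S = {(u, x). norm u \<le> 1 \<and> x \<in> P \<and> norm x \<le> 1 \<and> reflect u x \<in> Q}"
    have S: "S \<in> sets (lborel \<Otimes>\<^sub>M lborel)"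
    proof -
      have "{z \<in> space (borel \<Otimes>\<^sub>M borel). norm (fst z) \<le> 1 \<and> snd z \<in> P \<and> norm (snd z) \<le> 1 \<and>
         (case z of (u, x) \<Rightarrow> reflect u x) \<in> Q} \<in> sets (borel \<Otimes>\<^sub>M borel)"
        by measurable
      then show ?thesis
        by (simp add: S_def split_beta' space_pair_measure cong: sets_pair_measure_cong)
    qed
    \<comment> \<open>The origin, a null set, is removed because no reflection moves it.\<close>
    have "ennreal (vol Q / K) * emeasure lborel (P \<inter> cball 0 1 - {0})
       = (\<integral>\<^sup>+x. ennreal (vol Q / K) * indicator (P \<inter> cball 0 1 - {0}) x \<partial>lborel)"
      by (subst nn_integral_cmult_indicator) auto
    also have "\<dots> \<le> (\<integral>\<^sup>+x. emeasure lborel ((\<lambda>u. (u, x)) -` S) \<partial>lborel)"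
    proof (intro nn_integral_mono)
      fix x :: "real ^ 'm::_"
      show "ennreal (vol Q / K) * indicator (P \<inter> cball 0 1 - {0}) x \<le> emeasure lborel ((\<lambda>u. (u, x)) -` S)"
      proof (cases "x \<in> P \<inter> cball 0 1 - {0}")
        case True
        then have "(\<lambda>u. (u, x)) -` S = {u. reflect u x \<in> Q} \<inter> cball 0 1"
          by (auto simp: S_def)
        moreover have "vol Q / K \<le> vol {u. reflect u x \<in> Q}"
          using vol_le_vol_reflections[of x Q] True Q disj \<open>0 < K\<close> by (auto simp: field_simps K_def)
        ultimately show ?thesis using True
          by (simp add: emeasure_Int_cball ennreal_leI)
      qed auto
    qed
    also have "\<dots> = emeasure (lborel \<Otimes>\<^sub>M lborel) S"
      using lborel_pair.emeasure_pair_measure_alt2[OF S] by simp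
    also have "\<dots> = (\<integral>\<^sup>+u. emeasure lborel (Pair u -` S) \<partial>lborel)"
      by (rule lborel.emeasure_pair_measure_alt[OF S])
    also have "\<dots> \<le> (\<integral>\<^sup>+(u :: real ^ 'm::_). ennreal s * indicator (cball 0 1) u \<partial>lborel)"
    proof (intro nn_integral_mono)
      fix u :: "real ^ 'm::_"
      show "emeasure lborel (Pair u -` S) \<le> ennreal s * indicator (cball 0 1) u"
      proof (cases "u \<in> cball 0 1")
        case True
        then have "Pair u -` S = {x \<in> P. reflect u x \<in> Q} \<inter> cball 0 1"
          by (auto simp: S_def)
        then show ?thesis using True less[of u]
          by (simp add: emeasure_Int_cball ennreal_leI)
      next
        case False
        then have "Pair u -` S = {}" by (auto simp: S_def)
        then show ?thesis by simp
      qed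
    qed
    also have "\<dots> = ennreal s * ennreal ?V"
      by (subst nn_integral_cmult_indicator) (auto simp: emeasure_Int_cball[of UNIV, simplified])
    also have "emeasure lborel (P \<inter> cball 0 1 - {0}) = emeasure lborel (P \<inter> cball 0 1)"
      by (intro emeasure_Diff_null_set) auto
    finally have "ennreal (vol Q / K) * ennreal (vol P) \<le> ennreal s * ennreal ?V"
      by (simp add: emeasure_Int_cball)
    moreover have "0 \<le> s" using pos by (simp add: s_def)
    ultimately have "ennreal (vol Q / K * vol P) \<le> ennreal (s * ?V)"
      using pos by (subst (1 2) ennreal_mult) auto
    then show False
      using pos by (subst (asm) ennreal_le_iff) (auto simp: s_def field_simps)
  qed
qed (auto simp: K_def)

section \<open>Polarizing towards the circular cone of half-angle pi/4\<close>

definition quarter_cone :: "'a::euclidean_space \<Rightarrow> 'a set" where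
  "quarter_cone e = {x. norm x \<le> sqrt 2 * (e \<bullet> x)}"

lemma borel_quarter_cone [measurable]: "quarter_cone e \<in> sets borel"
  unfolding quarter_cone_def by measurable

lemma pos_cone_quarter_cone: "pos_cone (quarter_cone e)"
  by (auto simp: pos_cone_def quarter_cone_def mult.left_commute)

text \<open>The excess volume forces \<open>A - quarter_cone e\<close> to have volume at least
  \<open>\<delta>\<close>. Some reflection therefore carries enough of it into the missing part
  \<open>quarter_cone e - A\<close> to fill at least the proportion \<open>\<delta> / K\<close> of
  that part.\<close>

lemma exists_polarization_improving:
  fixes A B :: "(real ^ 'm::{finite,wellorder}) set" and e :: "real ^ 'm::_"
  assumes A: "A \<in> sets borel" "pos_cone A" and B: "B \<in> sets borel" "pos_cone B"
    and AB: "\<And>x y. x \<in> A \<Longrightarrow> y \<in> B \<Longrightarrow> x \<bullet> y \<le> 0"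
    and \<delta>: "0 \<le> \<delta>" "vol (quarter_cone e) + \<delta> \<le> vol A"
  defines "K \<equiv> 2 * (fact CARD('m) * 6 ^ CARD('m)) * vol (UNIV :: (real ^ 'm::_) set)"
  obtains A' B' where "A' \<in> sets borel" "pos_cone A'" "B' \<in> sets borel" "pos_cone B'"
    "\<And>x y. x \<in> A' \<Longrightarrow> y \<in> B' \<Longrightarrow> x \<bullet> y \<le> 0" "vol A \<le> vol A'" "vol B \<le> vol B'"
    "vol (quarter_cone e - A') \<le> (1 - \<delta> / K) * vol (quarter_cone e - A)"
proof -
  let ?C = "quarter_cone e"
  have K: "K > 0" unfolding K_def by (intro mult_pos_pos vol_UNIV_pos) auto
  have "\<exists>u. vol (A - ?C) * vol (?C - A) / K \<le> vol {x \<in> A - ?C. reflect u x \<in> ?C - A}"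
    unfolding K_def using A by (intro exists_reflection_overlap) (auto intro: pos_cone_Diff pos_cone_quarter_cone)
  then obtain u0 where u0: "vol (A - ?C) * vol (?C - A) / K \<le> vol {x \<in> A - ?C. reflect u0 x \<in> ?C - A}"
    by blast
  \<comment> \<open>Both signs give the same reflection; this one makes the polarization push
    towards \<open>e\<close>, so that the circular cone is stable.\<close>
  define u where "u = (if e \<bullet> u0 \<ge> 0 then u0 else - u0)"
  have u: "e \<bullet> u \<ge> 0" "reflect u = reflect u0"
    by (auto simp: u_def reflect_uminus fun_eq_iff)
  have refl: "reflect u x \<in> ?C" if "x \<in> ?C" "u \<bullet> x \<le> 0" for x
  proof -
    have le: "e \<bullet> x \<le> e \<bullet> reflect u x"
      unfolding inner_reflect_eq using u(1) that
      by (simp add: inner_commute[of e] mult_nonneg_nonpos divide_nonpos_nonneg)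
    have "norm x \<le> sqrt 2 * (e \<bullet> x)" using that by (simp add: quarter_cone_def)
    also have "\<dots> \<le> sqrt 2 * (e \<bullet> reflect u x)" using le by (intro mult_left_mono) auto
    finally show ?thesis by (simp add: quarter_cone_def)
  qed
  have "vol A = vol (A \<inter> ?C) + vol (A - ?C)"
    using A by (intro vol_split) auto
  moreover have "vol (A \<inter> ?C) \<le> vol ?C"
    using A by (intro vol_mono) auto
  ultimately have "\<delta> \<le> vol (A - ?C)" using \<delta> by simp
  then have "\<delta> * vol (?C - A) / K \<le> vol (A - ?C) * vol (?C - A) / K"
    using K by (intro divide_right_mono mult_right_mono) auto
  also have "\<dots> \<le> vol {x \<in> A - ?C. reflect u x \<in> ?C - A}"
    using u0 u by simp
  finally have "vol (?C - polarize u A) \<le> (1 - \<delta> / K) * vol (?C - A)"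
    using vol_Diff_polarize[of A ?C u] refl A by (simp add: algebra_simps)
  moreover have "vol A \<le> vol (polarize u A)" "vol B \<le> vol (polarize (-u) B)"
    using A B by (auto intro: vol_polarize_ge)
  ultimately show ?thesis
    using A B AB by (intro that[of "polarize u A" "polarize (-u) B"])
      (auto intro: borel_polarize pos_cone_polarize polarize_inner_nonpos)
qed

text \<open>Polarizing never decreases \<open>vol A\<close>, so the excess over the circular cone
  stays at least \<open>\<delta>\<close>. Each step thus shrinks the missing part by the same factor
  \<open>q < 1\<close>, and the decay is geometric.\<close>

lemma exists_polar_pair_approximating:
  fixes A B :: "(real ^ 'm::{finite,wellorder}) set" and e :: "real ^ 'm::_"
  assumes A: "A \<in> sets borel" "pos_cone A" and B: "B \<in> sets borel" "pos_cone B"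
    and AB: "\<And>x y. x \<in> A \<Longrightarrow> y \<in> B \<Longrightarrow> x \<bullet> y \<le> 0"
    and less: "vol (quarter_cone e) < vol A" and "0 < \<epsilon>"
  obtains A' B' where "A' \<in> sets borel" "B' \<in> sets borel" "pos_cone B'"
    "\<And>x y. x \<in> A' \<Longrightarrow> y \<in> B' \<Longrightarrow> x \<bullet> y \<le> 0" "vol B \<le> vol B'" "vol (quarter_cone e - A') < \<epsilon>"
proof -
  let ?C = "quarter_cone e"
  define K where "K = 2 * (fact CARD('m) * 6 ^ CARD('m)) * vol (UNIV :: (real ^ 'm::_) set)"
  have K: "K > 0" unfolding K_def by (intro mult_pos_pos vol_UNIV_pos) auto
  define \<delta> where "\<delta> = vol A - vol ?C"
  \<comment> \<open>The maximum with 0 guards the multiplication by \<open>q\<close> and the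
    convergence of its powers without comparing \<open>\<delta>\<close> to \<open>K\<close>.\<close>
  define q where "q = max 0 (1 - \<delta> / K)"
  have q: "0 \<le> q" "q < 1" using less K by (auto simp: q_def \<delta>_def)
  have "\<exists>A' B'. A' \<in> sets borel \<and> pos_cone A' \<and> B' \<in> sets borel \<and> pos_cone B' \<and>
    (\<forall>x\<in>A'. \<forall>y\<in>B'. x \<bullet> y \<le> 0) \<and> vol A \<le> vol A' \<and> vol B \<le> vol B' \<and>
    vol (?C - A') \<le> q ^ n * vol (?C - A)" for n
  proof (induction n)
    case 0
    then show ?case using A B AB by (intro exI[of _ A] exI[of _ B]) auto
  next
    case (Suc n)
    then obtain A1 B1 where 1: "A1 \<in> sets borel" "pos_cone A1" "B1 \<in> sets borel" "pos_cone B1"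
      "\<forall>x\<in>A1. \<forall>y\<in>B1. x \<bullet> y \<le> 0" "vol A \<le> vol A1" "vol B \<le> vol B1"
      "vol (?C - A1) \<le> q ^ n * vol (?C - A)" by blast
    have \<delta>: "0 \<le> \<delta>" "vol ?C + \<delta> \<le> vol A1" using less 1 by (auto simp: \<delta>_def)
    obtain A' B' where 2: "A' \<in> sets borel" "pos_cone A'" "B' \<in> sets borel" "pos_cone B'"
      "\<And>x y. x \<in> A' \<Longrightarrow> y \<in> B' \<Longrightarrow> x \<bullet> y \<le> 0" "vol A1 \<le> vol A'" "vol B1 \<le> vol B'"
      "vol (?C - A') \<le> (1 - \<delta> / K) * vol (?C - A1)"
      using exists_polarization_improving[OF 1(1-4) _ \<delta>] 1(5) unfolding K_def by blast
    have "vol (?C - A') \<le> q * vol (?C - A1)"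
      using 2(8) by (rule order_trans) (auto simp: q_def intro: mult_right_mono)
    also have "\<dots> \<le> q ^ Suc n * vol (?C - A)"
      using mult_left_mono[OF 1(8) q(1)] by (simp add: mult_ac)
    finally show ?case
      using 1 2 by (intro exI[of _ A'] exI[of _ B']) auto
  qed
  moreover have "(\<lambda>n. q ^ n * vol (?C - A)) \<longlonglongrightarrow> 0"
    using q by (intro tendsto_mult_left_zero LIMSEQ_realpow_zero)
  then have "eventually (\<lambda>n. q ^ n * vol (?C - A) < \<epsilon>) sequentially"
    using \<open>0 < \<epsilon>\<close> by (rule order_tendstoD)
  then obtain n where "q ^ n * vol (?C - A) < \<epsilon>"
    by (auto simp: eventually_sequentially)
  ultimately show ?thesis using that by (meson order_le_less_trans)
qed

text \<open>
  With \<open>a = - e \<bullet> y\<close>, the witness \<open>p\<close> has component 1 along \<open>e\<close> and \<open>1 - \<eta> / 2\<close> along the part of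
  \<open>y\<close> orthogonal to \<open>e\<close>, so it lies just inside the cone (\<open>p = e\<close> if \<open>y\<close> is parallel to \<open>e\<close>,
  by division by 0).
\<close>

lemma vol_quarter_cone_Int_halfspace_ge:
  fixes e y :: "'a::euclidean_space"
  assumes e: "norm e = 1" and y: "norm y = 1" and \<eta>: "0 < \<eta>" "\<eta> \<le> 1"
    and ey: "- (e \<bullet> y) \<le> 1 / sqrt 2 - \<eta>"
  shows "(\<eta> / 24) ^ DIM('a) * measure lborel (ball (0 :: 'a) 1)
    \<le> vol {x \<in> quarter_cone e. x \<bullet> y > 0}"
proof -
  define a where "a = - (e \<bullet> y)"
  define w where "w = y + a *\<^sub>R e"
  define s where "s = norm w"
  have ee: "e \<bullet> e = 1" and yy: "y \<bullet> y = 1" using e y by (auto simp: norm_eq_1)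
  have we: "w \<bullet> e = 0" by (simp add: w_def a_def inner_diff_left inner_commute[of y e] ee)
  have "w \<bullet> w = w \<bullet> y + a * (w \<bullet> e)"
    by (simp only: w_def inner_add_right inner_scaleR_right)
  then have wy: "w \<bullet> y = s\<^sup>2"
    using we by (simp add: s_def power2_norm_eq_inner)
  have s2: "s\<^sup>2 = 1 - a\<^sup>2"
    unfolding wy[symmetric] by (simp add: w_def a_def inner_diff_left yy power2_eq_square)
  have s: "0 \<le> s" by (simp add: s_def)
  \<comment> \<open>\<open>a\<close> and \<open>s\<close> are the cosine and sine of the angle
    between \<open>y\<close> and \<open>- e\<close>. That angle exceeds pi/4, so the sine is the
    larger one.\<close>
  have sa: "\<eta> \<le> s - a"
  proof (cases "a \<le> 0")
    case True
    have "1\<^sup>2 \<le> (s - a)\<^sup>2" using True s s2 by (simp add: power2_diff mult_nonneg_nonpos)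
    then have "1 \<le> s - a" using True s by (intro power2_le_imp_le[of 1]) auto
    then show ?thesis using \<eta> by simp
  next
    case False
    have "a \<le> 1 / sqrt 2" using ey \<eta> by (simp add: a_def)
    then have "a\<^sup>2 \<le> (1 / sqrt 2)\<^sup>2" using False by (intro power_mono) auto
    then have "(1 / sqrt 2)\<^sup>2 \<le> s\<^sup>2" using s2 by (simp add: power_divide)
    then have "1 / sqrt 2 \<le> s" using s by (rule power2_le_imp_le)
    then show ?thesis using ey by (simp add: a_def)
  qed
  have "s\<^sup>2 \<le> 1\<^sup>2" using s2 by simp
  then have s1: "s \<le> 1" by (rule power2_le_imp_le) simp
  define p where "p = e + ((1 - \<eta> / 2) / s) *\<^sub>R w"
  have ep: "e \<bullet> p = 1" by (simp add: p_def inner_add_right inner_commute[of e w] we ee)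
  have "p \<bullet> y = - a + (1 - \<eta> / 2) * s"
    by (simp add: p_def inner_add_left wy power2_eq_square a_def)
  also have "\<dots> \<ge> \<eta> / 2"
  proof -
    have "\<eta> * s \<le> \<eta> * 1" using s1 \<eta> by (intro mult_left_mono) auto
    moreover have "(1 - \<eta> / 2) * s = s - \<eta> * s / 2" by (simp add: algebra_simps)
    ultimately show ?thesis using sa by linarith
  qed
  finally have py: "\<eta> / 2 \<le> p \<bullet> y" .
  have "norm p \<le> sqrt 2 - \<eta> / 4"
  proof (rule power2_le_imp_le)
    have "w \<bullet> w = s\<^sup>2" by (simp add: s_def power2_norm_eq_inner)
    then have "p \<bullet> p = 1 + ((1 - \<eta> / 2) / s)\<^sup>2 * s\<^sup>2"
      by (simp add: p_def inner_add_left inner_add_right inner_commute[of e w] we ee power2_eq_square)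
    then have "(norm p)\<^sup>2 = 1 + ((1 - \<eta> / 2) / s)\<^sup>2 * s\<^sup>2"
      by (simp add: power2_norm_eq_inner)
    also have "\<dots> \<le> 1 + (1 - \<eta> / 2)\<^sup>2"
      by (simp add: power_divide)
    also have "\<dots> \<le> (sqrt 2 - \<eta> / 4)\<^sup>2"
    proof -
      have "sqrt 2 \<le> 3 / 2" by (rule real_le_lsqrt) (auto simp: power2_eq_square)
      then have "\<eta> * sqrt 2 \<le> \<eta> * (3 / 2)" using \<eta> by (intro mult_left_mono) auto
      moreover have "\<eta>\<^sup>2 \<le> \<eta>" using \<eta> by (simp add: power2_eq_square mult_left_le)
      moreover have "(sqrt 2 - \<eta> / 4)\<^sup>2 = 2 - \<eta> * sqrt 2 / 2 + \<eta>\<^sup>2 / 16"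
        "(1 - \<eta> / 2)\<^sup>2 = 1 - \<eta> + \<eta>\<^sup>2 / 4"
        by (simp_all add: power2_diff power_divide)
      ultimately show ?thesis using \<eta> by linarith
    qed
    finally show "(norm p)\<^sup>2 \<le> (sqrt 2 - \<eta> / 4)\<^sup>2" .
    show "0 \<le> sqrt 2 - \<eta> / 4" using \<eta> real_sqrt_ge_one[of 2] by linarith
  qed
  note np = this
  \<comment> \<open>Halving \<open>p\<close> brings the ball into the unit ball. Its radius is small
    against the margins of \<open>p\<close>, which are \<open>\<eta> / 4\<close> in the norm and
    \<open>\<eta> / 2\<close> in the inner product with \<open>y\<close>, also after
    halving.\<close>
  have sub: "ball ((1/2) *\<^sub>R p) (\<eta> / 24) \<subseteq> {x \<in> quarter_cone e. x \<bullet> y > 0} \<inter> cball 0 1"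
  proof
    fix x assume "x \<in> ball ((1/2) *\<^sub>R p) (\<eta> / 24)"
    then have x: "norm (x - (1/2) *\<^sub>R p) < \<eta> / 24" by (simp add: dist_norm norm_minus_commute)
    define v where "v = x - (1/2) *\<^sub>R p"
    have v: "x = (1/2) *\<^sub>R p + v" "norm v \<le> \<eta> / 24" using x by (auto simp: v_def)
    have ev: "\<bar>e \<bullet> v\<bar> \<le> \<eta> / 24" using Cauchy_Schwarz_ineq2[of e v] e v by simp
    have vy: "\<bar>v \<bullet> y\<bar> \<le> \<eta> / 24" using Cauchy_Schwarz_ineq2[of v y] y v by simp
    have nx: "norm x \<le> sqrt 2 / 2 - \<eta> / 8 + \<eta> / 24"
      using norm_triangle_ineq[of "(1/2) *\<^sub>R p" v] np v by simp
    have r2: "sqrt 2 \<le> 3 / 2" by (rule real_le_lsqrt) (auto simp: power2_eq_square)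
    have "norm x \<le> 1" using nx \<eta> r2 by simp
    moreover have "x \<bullet> y > 0" using py vy \<eta> by (simp add: v(1) inner_add_left)
    moreover have "norm x \<le> sqrt 2 * (e \<bullet> x)"
    proof -
      have "sqrt 2 * (\<eta> / 24) \<le> 3 / 2 * (\<eta> / 24)" using \<eta> r2 by (intro mult_right_mono) auto
      moreover have "sqrt 2 * (1 / 2 - \<eta> / 24) \<le> sqrt 2 * (e \<bullet> x)"
        using ev ep by (intro mult_left_mono) (auto simp: v(1) inner_add_right)
      moreover have "sqrt 2 * (1 / 2 - \<eta> / 24) = sqrt 2 / 2 - sqrt 2 * (\<eta> / 24)"
        by (simp add: algebra_simps)
      ultimately show ?thesis using nx \<eta> by linarith
    qed
    ultimately show "x \<in> {x \<in> quarter_cone e. x \<bullet> y > 0} \<inter> cball 0 1"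
      by (simp add: quarter_cone_def)
  qed
  have "(\<eta> / 24) ^ DIM('a) * measure lborel (ball (0 :: 'a) 1) = measure lebesgue (ball ((1/2) *\<^sub>R p) (\<eta> / 24))"
    using \<eta> content_ball_conv_unit_ball[of "\<eta> / 24" "(1/2) *\<^sub>R p"] by simp
  also have "\<dots> \<le> vol {x \<in> quarter_cone e. x \<bullet> y > 0}"
    unfolding vol_def using sub
    by (intro measure_mono_fmeasurable lmeasurable_Int_cball) (auto, measurable)
  finally show ?thesis .
qed

lemma vol_uminus_quarter_cone:
  fixes e :: "real ^ 'm::{finite,wellorder}"
  shows "vol {y. norm y \<le> sqrt 2 * - (e \<bullet> y)} = vol (quarter_cone e)"
proof -
  have "{y. norm y \<le> sqrt 2 * - (e \<bullet> y)} = reflect e ` quarter_cone e"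
    by (auto simp: reflect_image quarter_cone_def inner_reflect_self)
  then show ?thesis by (simp add: vol_reflect_image)
qed

text \<open>If \<open>B\<close> were larger than the circular cone as well, it would not fit into
  some slightly wider cone \<open>D k\<close> around \<open>- e\<close>, and neither would any
  polarized \<open>B'\<close>. A vector of \<open>B'\<close> outside of \<open>D k\<close> has
  positive inner product with a definite volume of \<open>quarter_cone e\<close>. None of that
  volume can be in \<open>A'\<close>, although \<open>A'\<close> almost fills the cone.\<close>

theorem vol_polar_pair:
  fixes A B :: "(real ^ 'm::{finite,wellorder}) set" and e :: "real ^ 'm::_"
  assumes A: "A \<in> sets borel" "pos_cone A" and B: "B \<in> sets borel" "pos_cone B"
    and AB: "\<And>x y. x \<in> A \<Longrightarrow> y \<in> B \<Longrightarrow> x \<bullet> y \<le> 0"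
    and e: "norm e = 1" and less: "vol (quarter_cone e) < vol A"
  shows "vol B \<le> vol (quarter_cone e)"
proof (rule ccontr)
  assume "\<not> ?thesis"
  then have lessB: "vol (quarter_cone e) < vol B" by simp
  define D where "D = (\<lambda>k::nat. {y. (1 / sqrt 2 - 1 / real (Suc k)) * norm y \<le> - (e \<bullet> y)})"
  have D: "D k \<in> sets borel" for k unfolding D_def by measurable
  have "decseq (\<lambda>k. D k \<inter> cball 0 1)"
  proof (rule decseq_SucI)
    fix k
    have mono: "(1 / sqrt 2 - 1 / real (Suc k)) * norm y \<le> (1 / sqrt 2 - 1 / real (Suc (Suc k))) * norm y"
      for y :: "real ^ 'm::{finite,wellorder}"
      by (intro mult_right_mono) (auto simp: frac_le)
    show "D (Suc k) \<inter> cball 0 1 \<subseteq> D k \<inter> cball 0 1"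
    proof
      fix y :: "real ^ 'm::_" assume "y \<in> D (Suc k) \<inter> cball 0 1"
      then show "y \<in> D k \<inter> cball 0 1"
        using mono[of y] by (simp add: D_def)
    qed
  qed
  then have "(\<lambda>k. vol (D k)) \<longlonglongrightarrow> measure lebesgue (\<Inter>k. D k \<inter> cball 0 1)"
    unfolding vol_def using lmeasurable_Int_cball[OF D]
    by (intro Lim_measure_decseq) (auto simp: fmeasurable_def less_top[symmetric] simp del: emeasure_completion)
  also have "(\<Inter>k. D k \<inter> cball 0 1) = {y. norm y \<le> sqrt 2 * - (e \<bullet> y)} \<inter> cball 0 1"
  proof -
    have "norm y \<le> sqrt 2 * - (e \<bullet> y)" if y: "\<And>k. y \<in> D k" for y :: "real ^ 'm::{finite,wellorder}"
    proof -
      have "(\<lambda>k. (1 / sqrt 2 - 1 / real (Suc k)) * norm y) \<longlonglongrightarrow> (1 / sqrt 2 - 0) * norm y"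
        by (intro tendsto_intros LIMSEQ_inverse_real_of_nat[unfolded inverse_eq_divide])
      then have "(1 / sqrt 2 - 0) * norm y \<le> - (e \<bullet> y)"
        by (rule LIMSEQ_le_const2) (use y in \<open>auto simp: D_def\<close>)
      then show ?thesis by (simp add: field_simps)
    qed
    moreover have "y \<in> D k" if y: "norm y \<le> sqrt 2 * - (e \<bullet> y)" for y k
    proof -
      have "(1 / sqrt 2 - 1 / real (Suc k)) * norm y \<le> (1 / sqrt 2) * norm y"
        by (intro mult_right_mono) auto
      also have "\<dots> \<le> - (e \<bullet> y)" using y by (simp add: field_simps)
      finally show ?thesis by (simp add: D_def)
    qed
    ultimately show ?thesis by auto
  qed
  finally have "(\<lambda>k. vol (D k)) \<longlonglongrightarrow> vol (quarter_cone e)"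
    using vol_uminus_quarter_cone[of e] by (simp add: vol_def)
  then have "eventually (\<lambda>k. vol (D k) < vol B) sequentially"
    using lessB by (rule order_tendstoD)
  then obtain k where k: "vol (D k) < vol B" by (auto simp: eventually_sequentially)
  \<comment> \<open>This depends only on \<open>k\<close>, hence is fixed before \<open>A'\<close>
    and \<open>B'\<close> are chosen.\<close>
  define \<epsilon> where "\<epsilon> = (1 / real (Suc k) / 24) ^ DIM(real ^ 'm::_) * measure lborel (ball (0 :: real ^ 'm::_) 1)"
  have "\<epsilon> > 0" unfolding \<epsilon>_def by (intro mult_pos_pos zero_less_power) (auto simp: content_ball_pos)
  obtain A' B' where 1: "A' \<in> sets borel" "B' \<in> sets borel" "pos_cone B'"
    "\<And>x y. x \<in> A' \<Longrightarrow> y \<in> B' \<Longrightarrow> x \<bullet> y \<le> 0" "vol B \<le> vol B'" "vol (quarter_cone e - A') < \<epsilon>"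
    using exists_polar_pair_approximating[OF A B AB less \<open>\<epsilon> > 0\<close>] by blast
  have "\<not> B' \<subseteq> D k"
    using vol_mono[of B' "D k"] k 1 D by auto
  then obtain y0 where y0: "y0 \<in> B'" "y0 \<notin> D k" by auto
  then have "y0 \<noteq> 0" by (auto simp: D_def)
  define y where "y = y0 /\<^sub>R norm y0"
  have y: "norm y = 1" "y \<in> B'"
    using \<open>y0 \<noteq> 0\<close> pos_coneD[OF 1(3) y0(1)] by (auto simp: y_def)
  have "- (e \<bullet> y0) < (1 / sqrt 2 - 1 / real (Suc k)) * norm y0"
    using y0 by (auto simp: D_def)
  then have "- (e \<bullet> y) \<le> 1 / sqrt 2 - 1 / real (Suc k)"
    using \<open>y0 \<noteq> 0\<close> by (simp add: y_def field_simps)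
  then have "\<epsilon> \<le> vol {x \<in> quarter_cone e. x \<bullet> y > 0}"
    unfolding \<epsilon>_def using e y by (intro vol_quarter_cone_Int_halfspace_ge) auto
  also have "\<dots> \<le> vol (quarter_cone e - A')"
    using 1 y by (intro vol_mono) (auto simp: not_less[symmetric])
  finally show False using 1 by simp
qed

subsection \<open>Central projection\<close>

text \<open>
  An index type with one element more than \<open>'n\<close>.  The change-of-variables lemmas require it to be
  well-ordered, which \<open>'n option\<close> is not.
\<close>

typedef (overloaded) ('n::finite) upto_card = "{..CARD('n)}"
  by auto

setup_lifting type_definition_upto_card

instantiation upto_card :: (finite) linorder
begin
lift_definition less_eq_upto_card :: "'a upto_card \<Rightarrow> 'a upto_card \<Rightarrow> bool" is "(\<le>)" .
lift_definition less_upto_card :: "'a upto_card \<Rightarrow> 'a upto_card \<Rightarrow> bool" is "(<)" .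
instance by standard (transfer; auto)+
end

instance upto_card :: (finite) finite
  by standard (metis finite_atMost finite_imageI type_definition.Abs_image type_definition_upto_card)

instance upto_card :: (finite) wellorder
proof
  fix P :: "'a upto_card \<Rightarrow> bool" and a
  assume step: "\<And>x. (\<And>y. y < x \<Longrightarrow> P y) \<Longrightarrow> P x"
  show "P a"
    by (induction "Rep_upto_card a" arbitrary: a rule: less_induct)
       (metis step less_upto_card.rep_eq)
qed

definition coord0 :: "'n::finite upto_card" where
  "coord0 = Abs_upto_card 0"

text \<open>\<open>'n\<close> carries no order, so an arbitrary bijection onto the remaining indices
  is chosen.\<close>

definition coord :: "'n::finite \<Rightarrow> 'n upto_card" where
  "coord = (SOME f. bij_betw f UNIV (UNIV - {coord0}))"

lemma bij_betw_Rep_upto_card: "bij_betw Rep_upto_card (UNIV :: 'n::finite upto_card set) {..CARD('n)}"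
  by (simp add: bij_betw_def inj_on_def Rep_upto_card_inject type_definition.Rep_range[OF type_definition_upto_card])

lemma card_upto_card: "CARD('n::finite upto_card) = Suc CARD('n)"
  using bij_betw_same_card[OF bij_betw_Rep_upto_card] by simp

lemma bij_betw_coord: "bij_betw coord (UNIV :: 'n::finite set) (UNIV - {coord0})"
proof -
  have "card (UNIV :: 'n set) = card (UNIV - {coord0 :: 'n upto_card})"
    by (simp add: card_upto_card)
  then have "\<exists>f. bij_betw f (UNIV :: 'n set) (UNIV - {coord0 :: 'n upto_card})"
    by (intro finite_same_card_bij) auto
  then show ?thesis unfolding coord_def by (rule someI_ex)
qed

lemma coord_neq [simp]: "coord i \<noteq> coord0"
  using bij_betw_coord by (auto simp: bij_betw_def)

lemma upto_card_cases: obtains "i = coord0" | j where "i = coord j"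
  using bij_betw_coord by (auto simp: bij_betw_def)

lemma all_upto_card: "(\<forall>i. P i) \<longleftrightarrow> P coord0 \<and> (\<forall>j. P (coord j))"
  by (metis upto_card_cases)

lemma inj_coord [simp]: "coord i = coord j \<longleftrightarrow> i = j"
  using bij_betw_coord by (metis bij_betw_def inj_eq)

lemma sum_upto_card:
  fixes g :: "'n::finite upto_card \<Rightarrow> 'b::comm_monoid_add"
  shows "(\<Sum>i\<in>UNIV. g i) = g coord0 + (\<Sum>j\<in>UNIV. g (coord j))"
  using sum.remove[of UNIV coord0 g] sum.reindex_bij_betw[OF bij_betw_coord, of g] by simp

lemma prod_upto_card:
  fixes g :: "'n::finite upto_card \<Rightarrow> 'b::comm_monoid_mult"
  shows "(\<Prod>i\<in>UNIV. g i) = g coord0 * (\<Prod>j\<in>UNIV. g (coord j))"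
  using prod.remove[of UNIV coord0 g] prod.reindex_bij_betw[OF bij_betw_coord, of g] by simp

section \<open>Splitting off one coordinate\<close>

definition join :: "real \<Rightarrow> real ^ 'n::finite \<Rightarrow> real ^ 'n upto_card" where
  "join t z = (\<chi> i. if i = coord0 then t else z $ inv coord i)"

lemma join_coord0 [simp]: "join t z $ coord0 = t"
  by (simp add: join_def)

lemma join_coord [simp]: "join t z $ coord j = z $ j"
  by (simp add: join_def inv_f_f inj_def)

lemma join_surj: "join (x $ coord0) (\<chi> j. x $ coord j) = x"
  by (simp add: vec_eq_iff all_upto_card)

lemma inner_join: "join s w \<bullet> join t z = s * t + w \<bullet> z"
  by (simp add: inner_vec_def sum_upto_card)

lemma norm_join: "(norm (join t z))\<^sup>2 = t\<^sup>2 + (norm z)\<^sup>2"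
  unfolding power2_norm_eq_inner inner_join by (simp add: power2_eq_square)

lemma prod_Basis_vec: "(\<Prod>b\<in>Basis. (u - l :: real ^ 'm) \<bullet> b) = (\<Prod>i\<in>UNIV. u $ i - l $ i)"
proof -
  have "bij_betw (\<lambda>i. axis i 1) UNIV (Basis :: (real ^ 'm) set)"
    by (auto simp: bij_betw_def inj_on_def Basis_vec_def axis_eq_axis)
  from prod.reindex_bij_betw[OF this, of "\<lambda>b. (u - l) \<bullet> b"] show ?thesis
    by (simp add: inner_axis)
qed

lemma borel_measurable_vec_nth [measurable (raw)]:
  fixes f :: "'a \<Rightarrow> real ^ 'm"
  shows "f \<in> borel_measurable M \<Longrightarrow> (\<lambda>x. f x $ i) \<in> borel_measurable M"
  using borel_measurable_inner[of f M "\<lambda>_. axis i 1"] by (simp add: inner_axis)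

lemma borel_measurable_vec_lambda [measurable (raw)]:
  fixes f :: "'a \<Rightarrow> 'm::finite \<Rightarrow> real"
  assumes "\<And>i. (\<lambda>x. f x i) \<in> borel_measurable M"
  shows "(\<lambda>x. \<chi> i. f x i) \<in> borel_measurable M"
  using assms by (subst borel_measurable_euclidean_space) (auto simp: Basis_vec_def inner_axis)

lemma borel_measurable_join [measurable (raw)]:
  fixes f :: "'a \<Rightarrow> real" and g :: "'a \<Rightarrow> real ^ 'n::finite"
  assumes [measurable]: "f \<in> borel_measurable M" "g \<in> borel_measurable M"
  shows "(\<lambda>x. join (f x) (g x)) \<in> borel_measurable M"
proof -
  have "(\<lambda>x. if i = coord0 then f x else g x $ inv coord i) \<in> borel_measurable M" for i
    by (cases "i = coord0") simp_all
  then show ?thesis unfolding join_def by (rule borel_measurable_vec_lambda)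
qed

lemma lborel_join:
  "lborel = distr (lborel \<Otimes>\<^sub>M lborel) borel (\<lambda>(t, z). join t z :: real ^ 'n::finite upto_card)"
proof (rule lborel_eqI)
  fix l u :: "real ^ 'n upto_card"
  assume "\<And>b. b \<in> Basis \<Longrightarrow> l \<bullet> b \<le> u \<bullet> b"
  then have le: "l $ i \<le> u $ i" for i
    by (drule_tac x = "axis i 1" in meta_spec) (simp add: axis_in_Basis_iff inner_axis)
  define l' u' where "l' = (\<chi> j. l $ coord j)" and "u' = (\<chi> j. u $ coord j)"
  have "(\<lambda>(t, z). join t z) -` box l u \<inter> space (lborel \<Otimes>\<^sub>M lborel) = {l $ coord0<..<u $ coord0} \<times> box l' u'"
    by (auto simp: mem_box_cart all_upto_card l'_def u'_def space_pair_measure)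
  then have "emeasure (distr (lborel \<Otimes>\<^sub>M lborel) borel (\<lambda>(t, z). join t z)) (box l u)
     = emeasure (lborel \<Otimes>\<^sub>M lborel) ({l $ coord0<..<u $ coord0} \<times> box l' u')"
    by (subst emeasure_distr) auto
  also have "\<dots> = emeasure lborel {l $ coord0<..<u $ coord0} * emeasure lborel (box l' u')"
    by (rule lborel.emeasure_pair_measure_Times) auto
  also have "\<dots> = ennreal (\<Prod>b\<in>Basis. (u - l) \<bullet> b)"
    unfolding emeasure_lborel_box_eq prod_Basis_vec using le
    by (auto simp: prod_upto_card l'_def u'_def ennreal_mult prod_nonneg Basis_vec_def inner_axis)
  finally show "emeasure (distr (lborel \<Otimes>\<^sub>M lborel) borel (\<lambda>(t, z). join t z)) (box l u) =
    ennreal (\<Prod>b\<in>Basis. (u - l) \<bullet> b)" .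
qed simp

text \<open>This links the vector type on which the geometry takes place to the extensional
  functions in the definition of \<open>h\<close>.\<close>

lemma lborel_upto_card:
  "lborel = distr (\<Pi>\<^sub>M i\<in>{..CARD('n)}. lborel) borel (\<lambda>f. \<chi> i. f (Rep_upto_card i) :: real ^ 'n::finite upto_card)"
proof (rule lborel_eqI)
  fix l u :: "real ^ 'n upto_card"
  let ?N = "\<Pi>\<^sub>M i\<in>{..CARD('n)}. (lborel :: real measure)"
  let ?F = "\<lambda>f. \<chi> i. f (Rep_upto_card i) :: real ^ 'n upto_card"
  assume "\<And>b. b \<in> Basis \<Longrightarrow> l \<bullet> b \<le> u \<bullet> b"
  then have le: "l $ i \<le> u $ i" for i
    by (drule_tac x = "axis i 1" in meta_spec) (simp add: axis_in_Basis_iff inner_axis)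
  interpret product_sigma_finite "\<lambda>_::nat. lborel :: real measure" ..
  have Rep: "Rep_upto_card (i :: 'n upto_card) \<le> CARD('n)" for i
    using Rep_upto_card[of i] by simp
  have "?F \<in> ?N \<rightarrow>\<^sub>M borel"
    using Rep by (intro borel_measurable_vec_lambda measurable_component_singleton[of _ _ "\<lambda>_. borel", simplified]) auto
  moreover have "?F -` box l u \<inter> space ?N = (\<Pi>\<^sub>E i\<in>{..CARD('n)}. {l $ Abs_upto_card i<..<u $ Abs_upto_card i})"
  proof (intro set_eqI iffI)
    fix f assume "f \<in> ?F -` box l u \<inter> space ?N"
    then show "f \<in> (\<Pi>\<^sub>E i\<in>{..CARD('n)}. {l $ Abs_upto_card i<..<u $ Abs_upto_card i})"
      by (auto simp: mem_box_cart space_PiM PiE_iff) (metis Abs_upto_card_inverse atMost_iff)+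
  next
    fix f assume "f \<in> (\<Pi>\<^sub>E i\<in>{..CARD('n)}. {l $ Abs_upto_card i<..<u $ Abs_upto_card i})"
    then show "f \<in> ?F -` box l u \<inter> space ?N"
      using Rep by (auto simp: mem_box_cart space_PiM PiE_iff) (metis Rep_upto_card_inverse atMost_iff)+
  qed
  ultimately have "emeasure (distr ?N borel ?F) (box l u)
     = emeasure ?N (\<Pi>\<^sub>E i\<in>{..CARD('n)}. {l $ Abs_upto_card i<..<u $ Abs_upto_card i})"
    by (subst emeasure_distr) auto
  also have "\<dots> = (\<Prod>i\<in>{..CARD('n)}. emeasure lborel {l $ Abs_upto_card i<..<u $ Abs_upto_card i :: real})"
    by (subst emeasure_PiM) auto
  also have "\<dots> = (\<Prod>i\<in>UNIV. ennreal (u $ i - l $ i))"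
    using prod.reindex_bij_betw[OF bij_betw_Rep_upto_card[where 'n = 'n], of "\<lambda>i. emeasure lborel {l $ Abs_upto_card i<..<u $ Abs_upto_card i :: real}"] le
    by (simp add: Rep_upto_card_inverse)
  also have "\<dots> = ennreal (\<Prod>b\<in>Basis. (u - l) \<bullet> b)"
    unfolding prod_Basis_vec using le by (intro prod_ennreal) auto
  finally show "emeasure (distr ?N borel ?F) (box l u) = ennreal (\<Prod>b\<in>Basis. (u - l) \<bullet> b)" .
qed simp

text \<open>The slice \<open>x $ coord0 = 1\<close> is a copy of \<open>real ^ 'n\<close>, and this
  is the preimage of \<open>K\<close> under central projection to it from the open half-space. The
  apex is excluded.\<close>

definition cone_over :: "(real ^ 'n::finite) set \<Rightarrow> (real ^ 'n upto_card) set" where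
  "cone_over K = {x. 0 < x $ coord0 \<and> (\<chi> j. x $ coord j / x $ coord0) \<in> K}"

lemma join_in_cone_over: "join t z \<in> cone_over K \<longleftrightarrow> 0 < t \<and> (1 / t) *\<^sub>R z \<in> K"
proof -
  have "(\<chi> j. z $ j / t) = (1 / t) *\<^sub>R z" by (simp add: vec_eq_iff)
  then show ?thesis by (simp add: cone_over_def)
qed

lemma pos_cone_cone_over: "pos_cone (cone_over K)"
  by (auto simp: pos_cone_def cone_over_def)

lemma borel_cone_over [measurable]:
  assumes [measurable]: "K \<in> sets borel"
  shows "cone_over K \<in> sets borel"
  unfolding cone_over_def by measurable

text \<open>The slice at height \<open>t\<close> is a scaled piece of \<open>K\<close>, which
  contributes the factor \<open>t ^ CARD('n)\<close>. After exchanging the integrals,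
  \<open>t\<close> runs for fixed \<open>x\<close> from 0 to
  \<open>1 / sqrt (1 + (norm x)\<^sup>2)\<close>, where the ray through \<open>x\<close> leaves the
  unit ball.\<close>

lemma vol_cone_over:
  fixes K :: "(real ^ 'n::finite) set"
  assumes K [measurable]: "K \<in> sets borel"
  shows "ennreal (vol (cone_over K)) =
    (\<integral>\<^sup>+x. ennreal (1 / real (Suc CARD('n)) / sqrt (1 + (norm x)\<^sup>2) ^ Suc CARD('n)) * indicator K x \<partial>lborel)"
proof -
  let ?d = "CARD('n)"
  let ?J = "\<lambda>(t, z). join t z :: real ^ 'n upto_card"
  define S where "S = {(t, z :: real ^ 'n). 0 < t \<and> (1 / t) *\<^sub>R z \<in> K \<and> t\<^sup>2 + (norm z)\<^sup>2 \<le> 1}"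
  have "{x \<in> space (borel \<Otimes>\<^sub>M borel). 0 < fst x \<and> (1 / fst x) *\<^sub>R snd x \<in> K \<and> (fst x)\<^sup>2 + (norm (snd x))\<^sup>2 \<le> 1}
     \<in> sets (borel \<Otimes>\<^sub>M borel)"
    by measurable
  then have S: "S \<in> sets (lborel \<Otimes>\<^sub>M lborel)"
    by (simp add: S_def split_beta' space_pair_measure cong: sets_pair_measure_cong)
  have eqS: "?J -` (cone_over K \<inter> cball 0 1) \<inter> space (lborel \<Otimes>\<^sub>M lborel) = S"
  proof -
    have "norm (join t z) \<le> 1 \<longleftrightarrow> t\<^sup>2 + (norm z)\<^sup>2 \<le> 1" for t and z :: "real ^ 'n"
      unfolding norm_join[symmetric] by (simp add: abs_square_le_1)
    then show ?thesis
      by (auto simp: S_def space_pair_measure join_in_cone_over)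
  qed
  have "ennreal (vol (cone_over K)) = emeasure lborel (cone_over K \<inter> cball 0 1)"
    using K by (simp add: emeasure_Int_cball)
  also have "\<dots> = emeasure (lborel \<Otimes>\<^sub>M lborel) S"
    unfolding eqS[symmetric] by (subst lborel_join, subst emeasure_distr) (auto simp: split_beta')
  also have "\<dots> = (\<integral>\<^sup>+t. emeasure lborel (Pair t -` S) \<partial>lborel)"
    by (rule lborel.emeasure_pair_measure_alt[OF S])
  \<comment> \<open>Admitting \<open>t = 0\<close> makes the later range of integration a closed
    interval; the factor \<open>t ^ CARD('n)\<close> vanishes there.\<close>
  also have "\<dots> = (\<integral>\<^sup>+t. (\<integral>\<^sup>+x. ennreal (t ^ ?d) * indicator {(t, x). 0 \<le> t \<and> x \<in> K \<and> t\<^sup>2 * (1 + (norm x)\<^sup>2) \<le> 1} (t, x) \<partial>lborel) \<partial>lborel)"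
  proof (intro nn_integral_cong)
    fix t :: real
    show "emeasure lborel (Pair t -` S) = (\<integral>\<^sup>+(x :: real ^ 'n). ennreal (t ^ ?d) * indicator {(t, x). 0 \<le> t \<and> x \<in> K \<and> t\<^sup>2 * (1 + (norm x)\<^sup>2) \<le> 1} (t, x) \<partial>lborel)"
    proof (cases "t > 0")
      case True
      define X where "X = {x \<in> K. t\<^sup>2 * (1 + (norm x)\<^sup>2) \<le> 1}"
      have [measurable]: "X \<in> sets borel" unfolding X_def by measurable
      have PS: "Pair t -` S \<in> sets borel"
        using sets_Pair1[OF S, of t] by simp
      have pre: "(\<lambda>x. 0 + t *\<^sub>R x) -` (Pair t -` S) = X"
        using True by (auto simp: S_def X_def power_mult_distrib algebra_simps)
      have "emeasure lborel (Pair t -` S)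
         = emeasure (density (distr lborel borel (\<lambda>x. 0 + t *\<^sub>R x)) (\<lambda>_. ennreal (\<bar>t\<bar> ^ DIM(real ^ 'n)))) (Pair t -` S)"
        using True by (subst lborel_affine[of t 0]) auto
      also have "\<dots> = ennreal (t ^ ?d) * emeasure lborel X"
        using True PS pre by (subst emeasure_density_const) (auto simp: emeasure_distr)
      also have "\<dots> = (\<integral>\<^sup>+x. ennreal (t ^ ?d) * indicator X x \<partial>lborel)"
        by (subst nn_integral_cmult_indicator) auto
      finally show ?thesis
        using True by (simp add: X_def indicator_def)
    next
      case False
      then have "Pair t -` S = {}" by (auto simp: S_def)
      moreover have "(\<integral>\<^sup>+(x :: real ^ 'n). ennreal (t ^ ?d) * indicator {(t, x). 0 \<le> t \<and> x \<in> K \<and> t\<^sup>2 * (1 + (norm x)\<^sup>2) \<le> 1} (t, x) \<partial>lborel)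
         = (\<integral>\<^sup>+(x :: real ^ 'n). 0 \<partial>lborel)"
        by (intro nn_integral_cong) (use False in \<open>auto simp: indicator_def\<close>)
      ultimately show ?thesis by simp
    qed
  qed
  also have "\<dots> = (\<integral>\<^sup>+x. (\<integral>\<^sup>+t. ennreal (t ^ ?d) * indicator {(t, x). 0 \<le> t \<and> x \<in> K \<and> t\<^sup>2 * (1 + (norm x)\<^sup>2) \<le> 1} (t, x) \<partial>lborel) \<partial>lborel)"
  proof -
    have "{x \<in> space (borel \<Otimes>\<^sub>M borel). 0 \<le> fst x \<and> snd x \<in> K \<and> (fst x)\<^sup>2 * (1 + (norm (snd x))\<^sup>2) \<le> 1}
     \<in> sets (borel \<Otimes>\<^sub>M borel)" by measurable
    then have [measurable]: "{(t, x). 0 \<le> t \<and> x \<in> K \<and> t\<^sup>2 * (1 + (norm x)\<^sup>2) \<le> 1} \<in> sets (borel \<Otimes>\<^sub>M borel)"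
      by (simp add: split_beta' space_pair_measure)
    show ?thesis by (rule lborel_pair.Fubini'[symmetric]) measurable
  qed
  also have "\<dots> = (\<integral>\<^sup>+x. ennreal (1 / real (Suc ?d) / sqrt (1 + (norm x)\<^sup>2) ^ Suc ?d) * indicator K x \<partial>lborel)"
  proof (intro nn_integral_cong)
    fix x :: "real ^ 'n"
    define s where "s = 1 / sqrt (1 + (norm x)\<^sup>2)"
    have s: "0 < s" by (simp add: s_def add_pos_nonneg)
    have "t\<^sup>2 * (1 + (norm x)\<^sup>2) \<le> 1 \<longleftrightarrow> t \<le> s" if "0 \<le> t" for t
    proof -
      have "t\<^sup>2 * (1 + (norm x)\<^sup>2) = (t / s)\<^sup>2"
        by (simp add: s_def power_mult_distrib power_divide add_nonneg_nonneg)
      also have "\<dots> \<le> 1 \<longleftrightarrow> t / s \<le> 1"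
        using that s by (simp add: abs_square_le_1)
      finally show ?thesis using s by (simp add: field_simps)
    qed
    then have "(\<integral>\<^sup>+t. ennreal (t ^ ?d) * indicator {(t, x). 0 \<le> t \<and> x \<in> K \<and> t\<^sup>2 * (1 + (norm x)\<^sup>2) \<le> 1} (t, x) \<partial>lborel)
      = (\<integral>\<^sup>+t. ennreal (t ^ ?d) * indicator {0..s} t * indicator K x \<partial>lborel)"
      by (intro nn_integral_cong) (auto simp: indicator_def)
    also have "\<dots> = (\<integral>\<^sup>+t. ennreal (t ^ ?d) * indicator {0..s} t \<partial>lborel) * indicator K x"
      by (rule nn_integral_multc) measurable
    also have "(\<integral>\<^sup>+t. ennreal (t ^ ?d) * indicator {0..s} t \<partial>lborel)
       = ennreal (s ^ Suc ?d / real (Suc ?d) - 0 ^ Suc ?d / real (Suc ?d))"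
      using s by (intro nn_integral_FTC_Icc) (auto intro!: derivative_eq_intros simp del: of_nat_Suc power_Suc)
    also have "s ^ Suc ?d / real (Suc ?d) - 0 ^ Suc ?d / real (Suc ?d) = 1 / real (Suc ?d) / sqrt (1 + (norm x)\<^sup>2) ^ Suc ?d"
      by (simp add: s_def power_divide del: of_nat_Suc power_Suc)
    finally show "(\<integral>\<^sup>+t. ennreal (t ^ ?d) * indicator {(t, x). 0 \<le> t \<and> x \<in> K \<and> t\<^sup>2 * (1 + (norm x)\<^sup>2) \<le> 1} (t, x) \<partial>lborel)
       = ennreal (1 / real (Suc ?d) / sqrt (1 + (norm x)\<^sup>2) ^ Suc ?d) * indicator K x" .
  qed
  finally show ?thesis .
qed

text \<open>The integrand of \<open>vol_cone_over\<close>, normalised: the cone over the whole space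
  is half of the ball, whence the 2.\<close>

definition central_density :: "real ^ 'n::finite \<Rightarrow> real" where
  "central_density x = 2 / vol (UNIV :: (real ^ 'n upto_card) set) * (1 / real (Suc CARD('n)) / sqrt (1 + (norm x)\<^sup>2) ^ Suc CARD('n))"

definition central_measure :: "(real ^ 'n::finite) measure" where
  "central_measure = density lebesgue (\<lambda>x. ennreal (central_density x))"

lemma central_density_pos: "0 < central_density x"
  unfolding central_density_def using vol_UNIV_pos by (intro mult_pos_pos divide_pos_pos zero_less_power) (auto intro: add_pos_nonneg)

lemma continuous_on_central_density: "continuous_on S central_density"
proof -
  have "1 + (norm x)\<^sup>2 \<noteq> 0" for x :: "real ^ 'n"
    by (metis add_pos_nonneg less_numeral_extra(1) less_numeral_extra(3) zero_le_power2)
  then show ?thesis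
  unfolding central_density_def by (intro continuous_intros) auto
qed

lemma borel_measurable_central_density [measurable]: "central_density \<in> borel_measurable borel"
  by (intro borel_measurable_continuous_onI continuous_on_central_density)

lemma emeasure_central_measure:
  fixes K :: "(real ^ 'n::finite) set"
  assumes [measurable]: "K \<in> sets borel"
  shows "emeasure central_measure K = ennreal (2 * vol (cone_over K) / vol (UNIV :: (real ^ 'n upto_card) set))"
proof -
  let ?V = "vol (UNIV :: (real ^ 'n upto_card) set)"
  let ?g = "\<lambda>x :: real ^ 'n. 1 / real (Suc CARD('n)) / sqrt (1 + (norm x)\<^sup>2) ^ Suc CARD('n)"
  have "emeasure central_measure K = (\<integral>\<^sup>+x. ennreal (central_density x) * indicator K x \<partial>lebesgue)"
    unfolding central_measure_def by (intro emeasure_density) (auto intro: measurable_completion)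
  also have "\<dots> = (\<integral>\<^sup>+x. ennreal (central_density x) * indicator K x \<partial>lborel)"
    by (intro nn_integral_completion)
  also have "\<dots> = (\<integral>\<^sup>+x. ennreal (2 / ?V) * (ennreal (?g x) * indicator K x) \<partial>lborel)"
  proof (intro nn_integral_cong)
    fix x :: "real ^ 'n"
    have "ennreal (central_density x) = ennreal (2 / ?V) * ennreal (?g x)"
      unfolding central_density_def by (intro ennreal_mult) (auto intro!: divide_nonneg_nonneg)
    then show "ennreal (central_density x) * indicator K x = ennreal (2 / ?V) * (ennreal (?g x) * indicator K x)"
      by (simp only: mult.assoc)
  qed
  also have "\<dots> = ennreal (2 / ?V) * ennreal (vol (cone_over K))"
    by (subst nn_integral_cmult) (auto simp: vol_cone_over simp del: of_nat_Suc power_Suc)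
  finally show ?thesis
    using vol_UNIV_pos[where 'a = "real ^ 'n upto_card"] by (simp add: ennreal_mult[symmetric])
qed

lemma vol_cone_over_UNIV:
  "2 * vol (cone_over (UNIV :: (real ^ 'n::finite) set)) = vol (UNIV :: (real ^ 'n upto_card) set)"
proof -
  define e where "e = (axis coord0 1 :: real ^ 'n upto_card)"
  have e: "e \<bullet> x = x $ coord0" for x by (simp add: e_def inner_axis')
  have [measurable]: "cone_over (UNIV :: (real ^ 'n) set) \<in> sets borel" by simp
  let ?P = "{x :: real ^ 'n upto_card. 0 < x $ coord0}" and ?Z = "{x :: real ^ 'n upto_card. x $ coord0 = 0}"
  have P: "cone_over (UNIV :: (real ^ 'n) set) = ?P" by (simp add: cone_over_def)
  have [measurable]: "?P \<in> sets borel" "?Z \<in> sets borel" by measurable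
  have "negligible {x. e \<bullet> x = 0}"
    by (rule negligible_hyperplane) (simp add: e_def axis_eq_0_iff)
  then have nZ: "negligible ?Z" by (simp add: e)
  have Z: "vol ?Z = 0"
    unfolding vol_def by (rule negligible_imp_measure0, rule negligible_subset[OF nZ], blast)
  have "vol (UNIV :: (real ^ 'n upto_card) set) = vol (?P \<union> reflect e ` ?P \<union> ?Z)"
  proof -
    have "reflect e ` ?P = {x. x $ coord0 < 0}"
      using inner_reflect_self[of e] by (auto simp: reflect_image e[symmetric])
    then have "?P \<union> reflect e ` ?P \<union> ?Z = UNIV" by auto
    then show ?thesis by simp
  qed
  also have "\<dots> = vol (?P \<union> reflect e ` ?P) + vol ?Z"
    by (intro vol_Un) (auto simp: reflect_image e[symmetric] inner_reflect_self intro!: sets.Un borel_reflect_image)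
  also have "vol (?P \<union> reflect e ` ?P) = vol ?P + vol (reflect e ` ?P)"
    by (intro vol_Un) (auto simp: reflect_image e[symmetric] inner_reflect_self intro!: borel_reflect_image)
  finally show ?thesis by (simp add: P Z vol_reflect_image)
qed

lemma nice_central_measure: "nice_measure (central_measure :: (real ^ 'n::finite) measure)"
  unfolding nice_measure_def
proof (intro conjI exI[of _ central_density] allI impI)
  have "space (central_measure :: (real ^ 'n) measure) = UNIV" by (simp add: central_measure_def)
  then show "emeasure central_measure (space (central_measure :: (real ^ 'n) measure)) = 1"
    using vol_UNIV_pos[where 'a = "real ^ 'n upto_card"] by (simp add: emeasure_central_measure vol_cone_over_UNIV)
  show "continuous_on UNIV (central_density :: real ^ 'n \<Rightarrow> real)" by (rule continuous_on_central_density)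
  fix S :: "(real ^ 'n) set" assume "bounded S"
  then have "compact (closure S)" by (simp add: compact_closure)
  show "\<exists>c>0. \<forall>x\<in>S. c \<le> central_density x"
  proof (cases "S = {}")
    case False
    then obtain x0 where "x0 \<in> closure S" "\<forall>x\<in>closure S. central_density x0 \<le> central_density x"
      using continuous_attains_inf[OF \<open>compact (closure S)\<close> _ continuous_on_central_density] by auto
    then show ?thesis using closure_subset central_density_pos[of x0] by (intro exI[of _ "central_density x0"]) auto
  qed (auto intro: exI[of _ 1])
qed (simp add: central_measure_def)

text \<open>The frontier of a convex set is negligible, so passing to the interior loses no measure.
  The interior has a Borel cone and is also what \<open>avoids\<close> refers to.\<close>

lemma measure_central_measure_le:
  fixes K :: "(real ^ 'n::finite) set"
  assumes "convex K"
  shows "measure central_measure K \<le> 2 * vol (cone_over (interior K)) / vol (UNIV :: (real ^ 'n upto_card) set)"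
proof (cases "K \<in> sets lebesgue")
  case True
  have meas: "(\<lambda>x. ennreal (central_density x)) \<in> borel_measurable lebesgue"
    by (auto intro: measurable_completion)
  have AE: "AE x in lebesgue. x \<notin> frontier K"
    using negligible_convex_frontier[OF assms] by (intro AE_not_in) (simp add: negligible_iff_null_sets)
  have "emeasure central_measure K = (\<integral>\<^sup>+x. ennreal (central_density x) * indicator K x \<partial>lebesgue)"
    unfolding central_measure_def by (intro emeasure_density meas True)
  also have "\<dots> \<le> (\<integral>\<^sup>+x. ennreal (central_density x) * indicator (interior K) x \<partial>lebesgue)"
    using AE by (intro nn_integral_mono_AE, eventually_elim)
      (use closure_subset in \<open>auto simp: frontier_def indicator_def\<close>)
  also have "\<dots> = emeasure central_measure (interior K)"
    unfolding central_measure_def by (intro emeasure_density[symmetric] meas) auto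
  also have "\<dots> = ennreal (2 * vol (cone_over (interior K)) / vol (UNIV :: (real ^ 'n upto_card) set))"
    by (simp add: emeasure_central_measure)
  finally show ?thesis
    unfolding measure_def by (intro enn2real_leI) auto
\<comment> \<open>A set outside of the sigma-algebra has \<open>measure\<close> 0 by default, so
  measurability of \<open>K\<close> does not have to be established.\<close>
next
  case False
  then show ?thesis by (simp add: measure_notin_sets central_measure_def)
qed

subsection \<open>The measure of the cap\<close>

abbreviation lborel_upto :: "nat \<Rightarrow> (nat \<Rightarrow> real) measure" where
  "lborel_upto d \<equiv> \<Pi>\<^sub>M i\<in>{..d}. lborel"

lemma borel_measurable_l2norm [measurable]: "l2norm d \<in> borel_measurable (lborel_upto d)"
  unfolding l2norm_def by measurable

lemma borel_measurable_component_0: "(\<lambda>x. x 0) \<in> borel_measurable (lborel_upto d)"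
  using measurable_component_singleton[of 0 "{..d}" "\<lambda>_. lborel :: real measure"] by simp

lemma sets_upto_cone:
  "{x \<in> {..d} \<rightarrow>\<^sub>E UNIV. l2norm d x \<le> 1 \<and> l2norm d x \<le> sqrt 2 * x 0} \<in> sets (lborel_upto d)"
proof -
  have "{x \<in> space (lborel_upto d). l2norm d x \<le> 1} \<in> sets (lborel_upto d)"
    "{x \<in> space (lborel_upto d). l2norm d x \<le> sqrt 2 * x 0} \<in> sets (lborel_upto d)"
    by (intro borel_measurable_le borel_measurable_times borel_measurable_const borel_measurable_l2norm
        borel_measurable_component_0)+
  from sets.Int[OF this] show ?thesis
    by (rule back_subst[of "\<lambda>A. A \<in> _"]) (auto simp: space_PiM)
qed

lemma emeasure_l2norm_ball:
  "emeasure (lborel_upto d) {x \<in> {..d} \<rightarrow>\<^sub>E UNIV. l2norm d x \<le> 1} = ennreal (unit_ball_vol (real (Suc d)))"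
proof -
  have "{x \<in> {..d} \<rightarrow>\<^sub>E UNIV. l2norm d x \<le> 1} = {f. sqrt (\<Sum>i\<in>{..d}. (f i)\<^sup>2) \<le> 1} \<inter> space (lborel_upto d)"
    by (auto simp: l2norm_def space_PiM)
  then show ?thesis using emeasure_cball_aux[of "{..d}" 1] by simp
qed

lemma emeasure_lborel_upto_singleton: "emeasure (lborel_upto d) {x} = 0" if "x \<in> {..d} \<rightarrow>\<^sub>E UNIV"
proof -
  interpret product_sigma_finite "\<lambda>_::nat. lborel :: real measure" ..
  have "{x} = (\<Pi>\<^sub>E i\<in>{..d}. {x i})"
    using that by (simp add: PiE_singleton PiE_iff)
  then show ?thesis by (simp add: emeasure_PiM)
qed

text \<open>The points of the ball that project radially into the cap form the solid cone on the
  right without its apex. The apex is sent to itself, which is not on the sphere, but it is a null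
  set.\<close>

lemma h_quarter_pi:
  "h d (pi / 4) = measure (lborel_upto d) {x \<in> {..d} \<rightarrow>\<^sub>E UNIV. l2norm d x \<le> 1 \<and> l2norm d x \<le> sqrt 2 * x 0}
     / unit_ball_vol (real (Suc d))"
proof -
  let ?N = "lborel_upto d" and ?e = "\<lambda>i\<in>{..d}. if i = 0 then 1 else 0 :: real"
  define Ball where "Ball = {x \<in> {..d} \<rightarrow>\<^sub>E (UNIV :: real set). l2norm d x \<le> 1}"
  define G where "G = {x \<in> {..d} \<rightarrow>\<^sub>E (UNIV :: real set). l2norm d x \<le> 1 \<and> l2norm d x \<le> sqrt 2 * x 0}"
  define p where "p = (\<lambda>x. \<lambda>i\<in>{..d}. x i / l2norm d x)"
  have space: "space ?N = {..d} \<rightarrow>\<^sub>E UNIV" by (simp add: space_PiM)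
  have [measurable]: "p \<in> ?N \<rightarrow>\<^sub>M ?N" unfolding p_def by measurable
  have [measurable]: "Ball \<in> sets ?N" unfolding Ball_def space[symmetric] by measurable
  have Gs: "G \<in> sets ?N" unfolding G_def by (rule sets_upto_cone)
  have abs_le: "\<bar>x 0\<bar> \<le> l2norm d x" for x
    unfolding l2norm_def by (intro real_le_rsqrt) (simp add: member_le_sum[of 0 "{..d}" "\<lambda>i. (x i)\<^sup>2"])
  have inner_e: "(\<Sum>i\<le>d. ?e i * x i) = x 0" for x
    by (subst sum.remove[of _ 0]) (auto intro!: sum.neutral)
  have arccos_iff: "arccos t \<le> pi / 4 \<longleftrightarrow> 1 \<le> sqrt 2 * t" if "\<bar>t\<bar> \<le> 1" for t
  proof -
    have "pi / 4 = arccos (sqrt 2 / 2)"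
      using arccos_cos[of "pi / 4"] by (simp add: cos_45)
    moreover have "sqrt 2 / 2 \<le> 1"
      using real_sqrt_le_iff[of 2 4] by simp
    then have "arccos t \<le> arccos (sqrt 2 / 2) \<longleftrightarrow> sqrt 2 / 2 \<le> t"
      using arccos_le_mono[of t "sqrt 2 / 2"] that by simp
    ultimately have "arccos t \<le> pi / 4 \<longleftrightarrow> sqrt 2 / 2 \<le> t" by (simp only:)
    also have "\<dots> \<longleftrightarrow> 1 \<le> sqrt 2 * t"
    proof -
      have "sqrt 2 * (sqrt 2 / 2) = 1" by simp
      then show ?thesis by (metis mult_le_cancel_left_pos real_sqrt_gt_zero zero_less_numeral)
    qed
    finally show ?thesis .
  qed
  have cap: "spherical_cap d ?e (pi / 4) = {x \<in> space ?N. l2norm d x = 1 \<and> 1 \<le> sqrt 2 * x 0}"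
    using abs_le arccos_iff
    unfolding spherical_cap_def unit_sphere_def inner_e space by (auto; metis)
  have l2p: "l2norm d (p x) = (if l2norm d x = 0 then 0 else 1)" for x
  proof -
    have "l2norm d (p x) = sqrt (\<Sum>i\<le>d. (x i)\<^sup>2 / (l2norm d x)\<^sup>2)"
      unfolding l2norm_def[of d "p x"] by (simp add: p_def power_divide)
    also have "\<dots> = l2norm d x / l2norm d x"
      by (simp add: sum_divide_distrib[symmetric] real_sqrt_divide l2norm_def sum_nonneg)
    finally show ?thesis by simp
  qed
  have pos: "0 \<le> l2norm d x" for x by (simp add: l2norm_def sum_nonneg)
  have vimage: "Ball \<inter> (p -` spherical_cap d ?e (pi / 4) \<inter> space ?N) = G - {\<lambda>i\<in>{..d}. 0}"
  proof (intro set_eqI)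
    fix x
    have zero: "x = (\<lambda>i\<in>{..d}. 0) \<longleftrightarrow> l2norm d x = 0" if "x \<in> space ?N"
      using that by (auto simp: l2norm_def sum_nonneg_eq_0_iff space PiE_iff extensional_def fun_eq_iff)
    have ps: "p x \<in> space ?N" if "x \<in> space ?N" using that by (simp add: p_def space)
    have p0: "p x 0 = x 0 / l2norm d x" by (simp add: p_def)
    show "x \<in> Ball \<inter> (p -` spherical_cap d ?e (pi / 4) \<inter> space ?N) \<longleftrightarrow> x \<in> G - {\<lambda>i\<in>{..d}. 0}"
      using pos[of x] zero ps unfolding cap Ball_def G_def space[symmetric]
      by (auto simp: l2p p0 field_simps split: if_splits)
  qed
  have Ball: "emeasure ?N Ball = ennreal (unit_ball_vol (real (Suc d)))"
    unfolding Ball_def by (rule emeasure_l2norm_ball)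
  have null: "{\<lambda>i\<in>{..d}. 0} \<in> null_sets ?N"
  proof (rule null_setsI)
    have "{\<lambda>i\<in>{..d}. 0 :: real} = (\<Pi>\<^sub>E i\<in>{..d}. {0})"
      using PiE_singleton[of "\<lambda>i\<in>{..d}. 0 :: real" "{..d}"] by (simp cong: PiE_cong)
    also have "\<dots> \<in> sets ?N" by (intro sets_PiM_I_finite) auto
    finally show "{\<lambda>i\<in>{..d}. 0 :: real} \<in> sets ?N" .
  qed (rule emeasure_lborel_upto_singleton, auto)
  have capS: "spherical_cap d ?e (pi / 4) \<in> sets ?N"
  proof -
    have "{x \<in> space ?N. l2norm d x = 1} \<in> sets ?N" "{x \<in> space ?N. 1 \<le> sqrt 2 * x 0} \<in> sets ?N"
      by (intro borel_measurable_eq borel_measurable_le borel_measurable_times borel_measurable_const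
          borel_measurable_l2norm borel_measurable_component_0)+
    from sets.Int[OF this] show ?thesis
      unfolding cap by (rule back_subst[of "\<lambda>A. A \<in> _"]) auto
  qed
  have "h d (pi / 4) = measure (uniform_measure ?N Ball) (p -` spherical_cap d ?e (pi / 4) \<inter> space ?N)"
    unfolding h_def sphere_measure_def Ball_def[symmetric] p_def[symmetric]
    using capS by (subst measure_distr) auto
  also have "\<dots> = measure ?N (Ball \<inter> (p -` spherical_cap d ?e (pi / 4) \<inter> space ?N)) / measure ?N Ball"
    using capS unit_ball_vol_pos[of "real (Suc d)"]
    by (intro measure_uniform_measure) (auto simp: Ball simp del: of_nat_Suc unit_ball_vol_pos)
  also have "\<dots> = measure ?N G / unit_ball_vol (real (Suc d))"
    unfolding vimage using null Gs by (simp add: measure_Diff_null_set measure_def[of _ Ball] Ball del: of_nat_Suc)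
  finally show ?thesis by (simp only: G_def)
qed

text \<open>\<open>coord0\<close> stands for index 0, so the centre of the cap in the definition of
  \<open>h\<close> is the axis of the circular cone.\<close>

lemma h_card_eq_vol:
  "h CARD('n) (pi / 4) = vol (quarter_cone (axis coord0 1 :: real ^ 'n::finite upto_card)) / vol (UNIV :: (real ^ 'n upto_card) set)"
proof -
  let ?N = "lborel_upto CARD('n)"
  let ?F = "\<lambda>f. \<chi> i. f (Rep_upto_card i) :: real ^ 'n upto_card"
  let ?e = "axis coord0 1 :: real ^ 'n upto_card"
  have Rep: "Rep_upto_card (i :: 'n upto_card) \<le> CARD('n)" for i
    using Rep_upto_card[of i] by simp
  have F [measurable]: "?F \<in> ?N \<rightarrow>\<^sub>M borel"
    using Rep by (intro borel_measurable_vec_lambda measurable_component_singleton[of _ _ "\<lambda>_. borel", simplified]) auto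
  have norm: "norm (?F x) = l2norm CARD('n) x" for x
    using sum.reindex_bij_betw[OF bij_betw_Rep_upto_card[where 'n = 'n], of "\<lambda>i. (x i)\<^sup>2"]
    by (simp add: norm_vec_def L2_set_def l2norm_def)
  have e: "?e \<bullet> ?F x = x 0" for x
    by (simp add: inner_axis' coord0_def Abs_upto_card_inverse)
  have vol: "ennreal (vol S) = emeasure ?N {x \<in> {..CARD('n)} \<rightarrow>\<^sub>E UNIV. l2norm CARD('n) x \<le> 1 \<and> ?F x \<in> S}"
    if S [measurable]: "S \<in> sets borel" for S
  proof -
    have "ennreal (vol S) = emeasure (distr ?N borel ?F) (S \<inter> cball 0 1)"
      unfolding lborel_upto_card[symmetric] using S by (simp add: emeasure_Int_cball)
    also have "\<dots> = emeasure ?N (?F -` (S \<inter> cball 0 1) \<inter> space ?N)"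
      by (intro emeasure_distr) auto
    also have "?F -` (S \<inter> cball 0 1) \<inter> space ?N = {x \<in> {..CARD('n)} \<rightarrow>\<^sub>E UNIV. l2norm CARD('n) x \<le> 1 \<and> ?F x \<in> S}"
      by (auto simp: norm space_PiM)
    finally show ?thesis .
  qed
  have U: "vol (UNIV :: (real ^ 'n upto_card) set) = unit_ball_vol (real (Suc CARD('n)))"
    using vol[of UNIV] emeasure_l2norm_ball[of "CARD('n)"] by (simp del: of_nat_Suc)
  have "vol (quarter_cone ?e) = measure ?N {x \<in> {..CARD('n)} \<rightarrow>\<^sub>E UNIV. l2norm CARD('n) x \<le> 1 \<and> l2norm CARD('n) x \<le> sqrt 2 * x 0}"
  proof -
    have "{x \<in> {..CARD('n)} \<rightarrow>\<^sub>E UNIV. l2norm CARD('n) x \<le> 1 \<and> ?F x \<in> quarter_cone ?e}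
       = {x \<in> {..CARD('n)} \<rightarrow>\<^sub>E UNIV. l2norm CARD('n) x \<le> 1 \<and> l2norm CARD('n) x \<le> sqrt 2 * x 0}"
      by (simp add: quarter_cone_def norm e)
    then have "emeasure ?N {x \<in> {..CARD('n)} \<rightarrow>\<^sub>E UNIV. l2norm CARD('n) x \<le> 1 \<and> l2norm CARD('n) x \<le> sqrt 2 * x 0}
       = ennreal (vol (quarter_cone ?e))"
      by (simp only: vol[OF borel_quarter_cone])
    then show ?thesis by (simp only: measure_def enn2real_ennreal vol_nonneg)
  qed
  then show ?thesis unfolding U h_quarter_pi by simp
qed

section \<open>Volume ratio of unit balls in consecutive dimensions\<close>

lemma Gamma_half_ratio_le:
  assumes "x > (0 :: real)"
  shows "Gamma (x + 1/2) \<le> sqrt x * Gamma x"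
proof -
  have pos: "Gamma x > 0" "Gamma (x + 1/2) > 0" "Gamma (x + 1) > 0" using assms by auto
  have "(ln \<circ> Gamma) ((1 - 1/2) *\<^sub>R x + (1/2) *\<^sub>R (x + 1)) \<le> (1 - 1/2) * (ln \<circ> Gamma) x + 1/2 * (ln \<circ> Gamma) (x + 1)"
    using assms by (intro convex_onD[OF log_convex_Gamma_real]) auto
  moreover have "(1 - 1/2) *\<^sub>R x + (1/2) *\<^sub>R (x + 1) = x + 1/2" by (simp add: field_simps)
  ultimately have "2 * ln (Gamma (x + 1/2)) \<le> ln (Gamma x) + ln (Gamma (x + 1))" by simp
  then have "ln ((Gamma (x + 1/2))\<^sup>2) \<le> ln (Gamma x * Gamma (x + 1))"
    using pos by (simp add: ln_realpow ln_mult_pos)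
  then have "(Gamma (x + 1/2))\<^sup>2 \<le> Gamma x * Gamma (x + 1)"
    using pos by (subst (asm) ln_le_cancel_iff) auto
  also have "\<dots> = (sqrt x * Gamma x)\<^sup>2"
  proof -
    have "Gamma (x + 1) = x * Gamma x"
      using assms by (intro Gamma_plus1) (auto dest: nonpos_Ints_nonpos)
    then show ?thesis using assms by (simp add: power2_eq_square power_mult_distrib)
  qed
  finally show ?thesis
    by (rule power2_le_imp_le) (use assms pos in auto)
qed

lemma unit_ball_vol_ratio:
  "unit_ball_vol (real d) / unit_ball_vol (real (Suc d)) = Gamma (real d / 2 + 3/2) / Gamma (real d / 2 + 1) / sqrt pi"
proof -
  have "pi powr (real (Suc d) / 2) = pi powr (real d / 2) * sqrt pi"
    by (simp add: add_divide_distrib powr_add powr_half_sqrt)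
  moreover have "real (Suc d) / 2 + 1 = real d / 2 + 3/2" by (simp add: field_simps)
  ultimately show ?thesis unfolding unit_ball_vol_def by simp
qed

text \<open>The half-step inequality for \<open>Gamma\<close> at \<open>x\<close> gives the upper
  bound, and at \<open>x - 1/2\<close>, with the functional equation, the lower one. Both are
  asymptotic to \<open>sqrt (real d / (2 * pi))\<close>.\<close>

lemma unit_ball_vol_ratio_bounds:
  shows "unit_ball_vol (real d) / unit_ball_vol (real (Suc d)) \<le> sqrt (real d / 2 + 1) / sqrt pi"
    and "sqrt ((real d + 1) / 2) / sqrt pi \<le> unit_ball_vol (real d) / unit_ball_vol (real (Suc d))"
proof -
  define x where "x = real d / 2 + 1"
  have x: "x - 1/2 > 0" "x > 0" by (auto simp: x_def)
  have pos: "Gamma x > 0" "Gamma (x + 1/2) > 0" using x by auto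
  have eq: "unit_ball_vol (real d) / unit_ball_vol (real (Suc d)) = Gamma (x + 1/2) / Gamma x / sqrt pi"
    unfolding unit_ball_vol_ratio x_def by (simp add: add.assoc)
  show "unit_ball_vol (real d) / unit_ball_vol (real (Suc d)) \<le> sqrt (real d / 2 + 1) / sqrt pi"
    unfolding eq x_def[symmetric] using Gamma_half_ratio_le[OF x(2)] pos
    by (intro divide_right_mono) (auto simp: field_simps)
  have "Gamma x \<le> sqrt (x - 1/2) * Gamma (x - 1/2)"
    using Gamma_half_ratio_le[OF x(1)] by simp
  then have "sqrt (x - 1/2) * Gamma x \<le> sqrt (x - 1/2) * (sqrt (x - 1/2) * Gamma (x - 1/2))"
    using x by (intro mult_left_mono) auto
  also have "\<dots> = Gamma (x + 1/2)"
  proof -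
    have "Gamma (x - 1/2 + 1) = (x - 1/2) * Gamma (x - 1/2)"
      using x by (intro Gamma_plus1) (auto dest: nonpos_Ints_nonpos)
    moreover have "x - 1/2 + 1 = x + 1/2" by simp
    moreover have "sqrt (x - 1/2) * sqrt (x - 1/2) = x - 1/2" using x by simp
    ultimately show ?thesis by (metis mult.assoc)
  qed
  finally have "sqrt (x - 1/2) * Gamma x \<le> Gamma (x + 1/2)" .
  then show "sqrt ((real d + 1) / 2) / sqrt pi \<le> unit_ball_vol (real d) / unit_ball_vol (real (Suc d))"
  proof -
    assume "sqrt (x - 1/2) * Gamma x \<le> Gamma (x + 1/2)"
    then have "sqrt (x - 1/2) \<le> Gamma (x + 1/2) / Gamma x"
      using pos by (simp add: pos_le_divide_eq)
    moreover have "(real d + 1) / 2 = x - 1/2" by (simp add: x_def field_simps)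
    ultimately show ?thesis unfolding eq by (simp only:) (intro divide_right_mono, auto)
  qed
qed

section \<open>The cap as a one-dimensional integral\<close>

definition cap_integral :: "nat \<Rightarrow> real" where
  "cap_integral d = integral {0..1} (\<lambda>t. min t (sqrt (1 - t\<^sup>2)) ^ d)"

lemma min_sqrt_nonneg: "0 \<le> t \<Longrightarrow> t \<le> 1 \<Longrightarrow> 0 \<le> min t (sqrt (1 - t\<^sup>2))"
  by (simp add: power_le_one)

lemma cap_integrand_integrable:
  "0 \<le> a \<Longrightarrow> b \<le> 1 \<Longrightarrow> (\<lambda>t. min t (sqrt (1 - t\<^sup>2)) ^ d) integrable_on {a..b::real}"
  by (intro integrable_continuous_real continuous_intros)

text \<open>The slice at height \<open>t\<close> is a ball in dimension \<open>d\<close>, with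
  radius limited by the cone to \<open>t\<close> and by the unit ball to
  \<open>sqrt (1 - t\<^sup>2)\<close>.\<close>

lemma emeasure_upto_cone:
  "emeasure (lborel_upto d) {x \<in> {..d} \<rightarrow>\<^sub>E UNIV. l2norm d x \<le> 1 \<and> l2norm d x \<le> sqrt 2 * x 0}
     = ennreal (unit_ball_vol (real d) * cap_integral d)"
proof -
  interpret product_sigma_finite "\<lambda>_::nat. lborel :: real measure" ..
  define G where "G = {x \<in> {..d} \<rightarrow>\<^sub>E (UNIV :: real set). l2norm d x \<le> 1 \<and> l2norm d x \<le> sqrt 2 * x 0}"
  have G: "G \<in> sets (lborel_upto d)" unfolding G_def by (rule sets_upto_cone)
  have ins: "{..d} = insert 0 {1..d}" by auto
  let ?M = "\<Pi>\<^sub>M i\<in>{1..d}. (lborel :: real measure)"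
  have "emeasure (lborel_upto d) G = (\<integral>\<^sup>+x. indicator G x \<partial>lborel_upto d)"
    using G by simp
  also have "\<dots> = (\<integral>\<^sup>+t. (\<integral>\<^sup>+x. indicator G (x(0 := t)) \<partial>?M) \<partial>lborel)"
    using G unfolding ins by (subst product_nn_integral_insert_rev) auto
  also have "\<dots> = (\<integral>\<^sup>+t. ennreal (indicator {0..1} t * (unit_ball_vol (real d) * min t (sqrt (1 - t\<^sup>2)) ^ d)) \<partial>lborel)"
  proof (rule nn_integral_cong_AE)
    \<comment> \<open>At both ends the radius is 0; dropping them leaves only balls of positive
      radius to be measured.\<close>
    have "AE t in lborel. t \<notin> {0, 1::real}"
      by (intro AE_not_in countable_imp_null_set_lborel) auto
    then show "AE t in lborel. (\<integral>\<^sup>+x. indicator G (x(0 := t)) \<partial>?M)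
      = ennreal (indicator {0..1} t * (unit_ball_vol (real d) * min t (sqrt (1 - t\<^sup>2)) ^ d))"
    proof eventually_elim
      case (elim t)
      have sq: "(l2norm d (x(0 := t)))\<^sup>2 = t\<^sup>2 + (\<Sum>i\<in>{1..d}. (x i)\<^sup>2)" for x
      proof -
        have "(\<Sum>i\<le>d. ((x(0 := t)) i)\<^sup>2) = t\<^sup>2 + (\<Sum>i\<in>{1..d}. ((x(0 := t)) i)\<^sup>2)"
          unfolding ins by (subst sum.insert) auto
        also have "(\<Sum>i\<in>{1..d}. ((x(0 := t)) i)\<^sup>2) = (\<Sum>i\<in>{1..d}. (x i)\<^sup>2)"
          by (intro sum.cong) auto
        finally show ?thesis by (simp add: l2norm_def sum_nonneg)
      qed
      have l2: "0 \<le> l2norm d x" for x by (simp add: l2norm_def sum_nonneg)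
      have le1: "l2norm d (x(0 := t)) \<le> 1 \<longleftrightarrow> t\<^sup>2 + (\<Sum>i\<in>{1..d}. (x i)\<^sup>2) \<le> 1" for x
        unfolding sq[symmetric] using l2 by (simp add: abs_square_le_1)
      show ?case
      proof (cases "0 < t \<and> t < 1")
        case True
        define r where "r = min t (sqrt (1 - t\<^sup>2))"
        have "t\<^sup>2 < 1" using True by (simp add: power_less_one_iff abs_square_less_1)
        then have r: "0 < r" using True by (simp add: r_def)
        have "x(0 := t) \<in> G \<longleftrightarrow> x \<in> {f. sqrt (\<Sum>i\<in>{1..d}. (f i)\<^sup>2) \<le> r} \<inter> space ?M" if x: "x \<in> space ?M" for x
        proof -
          have s: "0 \<le> (\<Sum>i\<in>{1..d}. (x i)\<^sup>2)" by (rule sum_nonneg) simp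
          have "x(0 := t) \<in> {..d} \<rightarrow>\<^sub>E UNIV"
            using x unfolding ins by (auto simp: space_PiM PiE_iff extensional_def)
          moreover have "l2norm d (x(0 := t)) \<le> sqrt 2 * t \<longleftrightarrow> (l2norm d (x(0 := t)))\<^sup>2 \<le> (sqrt 2 * t)\<^sup>2"
            using True l2 by (intro power_mono_iff[symmetric]) auto
          moreover have "(l2norm d (x(0 := t)))\<^sup>2 \<le> (sqrt 2 * t)\<^sup>2 \<longleftrightarrow> (\<Sum>i\<in>{1..d}. (x i)\<^sup>2) \<le> t\<^sup>2"
            unfolding sq by (simp add: power_mult_distrib)
          moreover have "sqrt (\<Sum>i\<in>{1..d}. (x i)\<^sup>2) \<le> t \<longleftrightarrow> (\<Sum>i\<in>{1..d}. (x i)\<^sup>2) \<le> t\<^sup>2"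
            using True s by (intro real_sqrt_le_iff') auto
          ultimately show ?thesis using x by (auto simp: G_def le1 r_def)
        qed
        then have "(\<integral>\<^sup>+x. indicator G (x(0 := t)) \<partial>?M)
          = (\<integral>\<^sup>+x. indicator ({f. sqrt (\<Sum>i\<in>{1..d}. (f i)\<^sup>2) \<le> r} \<inter> space ?M) x \<partial>?M)"
          by (intro nn_integral_cong) (simp add: indicator_def)
        also have "\<dots> = emeasure ?M ({f. sqrt (\<Sum>i\<in>{1..d}. (f i)\<^sup>2) \<le> r} \<inter> space ?M)"
          by (rule nn_integral_indicator) measurable
        also have "\<dots> = ennreal (unit_ball_vol (real d) * r ^ d)"
          using emeasure_cball_aux[of "{1..d}" r] r by simp
        finally show ?thesis using True by (simp add: r_def)
      next
        case False
        have "x(0 := t) \<notin> G" for x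
        proof
          assume x: "x(0 := t) \<in> G"
          have s: "0 \<le> (\<Sum>i\<in>{1..d}. (x i)\<^sup>2)" by (rule sum_nonneg) simp
          have "t\<^sup>2 \<le> 1" using x s by (auto simp: G_def le1)
          then have "t \<le> 1" by (simp add: abs_square_le_1)
          moreover have "0 \<le> sqrt 2 * t" using x l2[of "x(0 := t)"] by (auto simp: G_def)
          then have "0 \<le> t" by (simp add: zero_le_mult_iff)
          ultimately show False using False elim by auto
        qed
        then show ?thesis using False elim by (auto simp: indicator_def)
      qed
    qed
  qed
  also have "\<dots> = ennreal (unit_ball_vol (real d) * cap_integral d)"
    unfolding cap_integral_def using min_sqrt_nonneg
    by (intro nn_integral_has_integral_lebesgue has_integral_mult_right integrable_integral cap_integrand_integrable)
       (auto intro!: mult_nonneg_nonneg zero_le_power)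
  finally show ?thesis by (simp add: G_def)
qed

lemma h_quarter_pi_eq:
  "h d (pi / 4) = unit_ball_vol (real d) / unit_ball_vol (real (Suc d)) * cap_integral d"
proof -
  have "0 \<le> cap_integral d"
    unfolding cap_integral_def by (intro integral_nonneg cap_integrand_integrable zero_le_power min_sqrt_nonneg) auto
  then show ?thesis
    unfolding h_quarter_pi measure_def emeasure_upto_cone by (simp del: of_nat_Suc)
qed

lemma has_integral_mult_sqrt_power:
  assumes "0 \<le> a" "a \<le> 1"
  shows "((\<lambda>t. t * sqrt (1 - t\<^sup>2) ^ k) has_integral sqrt (1 - a\<^sup>2) ^ (k + 2) / real (k + 2)) {a..1}"
proof -
  have "((\<lambda>t. t * sqrt (1 - t\<^sup>2) ^ k) has_integral
    (- (sqrt (1 - 1\<^sup>2) ^ (k + 2) / real (k + 2))) - (- (sqrt (1 - a\<^sup>2) ^ (k + 2) / real (k + 2)))) {a..1}"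
  \<comment> \<open>The square root is not differentiable at \<open>t = 1\<close>, so derivatives
    are taken in the open interval only.\<close>
  proof (rule fundamental_theorem_of_calculus_interior)
    fix t assume t: "t \<in> {a<..<1}"
    then have "t\<^sup>2 < 1" using assms by (simp add: abs_square_less_1)
    then have r: "0 < sqrt (1 - t\<^sup>2)" by simp
    have D: "((\<lambda>t. sqrt (1 - t\<^sup>2)) has_real_derivative - t / sqrt (1 - t\<^sup>2)) (at t)"
      using \<open>t\<^sup>2 < 1\<close> by (auto intro!: derivative_eq_intros simp: field_simps)
    have "k + 2 - Suc 0 = k + 1" by simp
    then have "((\<lambda>t. - (sqrt (1 - t\<^sup>2) ^ (k + 2) / real (k + 2))) has_real_derivative
      - (real (k + 2) * (- t / sqrt (1 - t\<^sup>2) * sqrt (1 - t\<^sup>2) ^ (k + 1)) / real (k + 2))) (at t)"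
      using DERIV_minus[OF DERIV_cdivide[OF DERIV_power[OF D, of "k + 2"], of "real (k + 2)"]] by (simp only:)
    also have "- (real (k + 2) * (- t / sqrt (1 - t\<^sup>2) * sqrt (1 - t\<^sup>2) ^ (k + 1)) / real (k + 2)) = t * sqrt (1 - t\<^sup>2) ^ k"
      using r by simp
    finally show "((\<lambda>t. - (sqrt (1 - t\<^sup>2) ^ (k + 2) / real (k + 2))) has_vector_derivative t * sqrt (1 - t\<^sup>2) ^ k) (at t)"
      by (simp add: has_real_derivative_iff_has_vector_derivative)
  qed (use assms in \<open>auto intro!: continuous_intros\<close>)
  then show ?thesis by simp
qed

text \<open>
  On \<open>{1 / sqrt 2..1}\<close> the integrand is compared with multiples of \<open>t * sqrt (1 - t\<^sup>2) ^ k\<close>, which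
  have elementary primitives: \<open>1 \<le> sqrt 2 * t\<close>, and \<open>sqrt 2 * (1 / 2 + (1 - t\<^sup>2))\<close> is the tangent of
  \<open>1 / t\<close> as a convex function of \<open>t\<^sup>2\<close> at \<open>t\<^sup>2 = 1 / 2\<close>.
\<close>

lemma cap_integral_bounds:
  fixes d :: nat
  defines "a \<equiv> 1 / sqrt 2"
  shows "cap_integral d \<le> a ^ Suc d * (1 / (real d + 1) + 1 / (real d + 2))"
    and "a ^ Suc d * (1 / (real d + 1) + 1 / 2 / (real d + 2) + 1 / 2 / (real d + 4)) \<le> cap_integral d"
proof -
  have a: "0 < a" "a < 1" "a\<^sup>2 = 1 / 2" "sqrt 2 * a = 1" and ra: "sqrt (1 - a\<^sup>2) = a"
    by (auto simp: a_def power_divide real_sqrt_divide)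
  let ?f = "\<lambda>t. min t (sqrt (1 - t\<^sup>2)) ^ d" and ?r = "\<lambda>t. sqrt (1 - t\<^sup>2)"
  \<comment> \<open>At \<open>a\<close> the two branches of the minimum meet.\<close>
  have "cap_integral d = integral {0..a} ?f + integral {a..1} ?f"
    unfolding cap_integral_def using a
    by (intro Henstock_Kurzweil_Integration.integral_combine[symmetric] cap_integrand_integrable) auto
  also have "integral {0..a} ?f = integral {0..a} (\<lambda>t. t ^ d)"
  proof (intro integral_cong)
    fix t assume t: "t \<in> {0..a}"
    then have "t\<^sup>2 \<le> a\<^sup>2" by (intro power_mono) auto
    then have "t \<le> ?r t" using a t by (intro real_le_rsqrt) auto
    then show "?f t = t ^ d" by simp
  qed
  also have "integral {0..a} (\<lambda>t. t ^ d) = a ^ Suc d / (real d + 1)"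
  proof -
    have "((\<lambda>t. t ^ d) has_integral a ^ Suc d / real (Suc d) - 0 ^ Suc d / real (Suc d)) {0..a}"
      using a by (intro fundamental_theorem_of_calculus)
        (auto intro!: derivative_eq_intros simp: has_real_derivative_iff_has_vector_derivative[symmetric] simp del: of_nat_Suc power_Suc)
    then show ?thesis by (simp add: integral_unique add.commute)
  qed
  also have "integral {a..1} ?f = integral {a..1} (\<lambda>t. ?r t ^ d)"
  proof (intro integral_cong)
    fix t assume t: "t \<in> {a..1}"
    then have "a\<^sup>2 \<le> t\<^sup>2" using a by (intro power_mono) auto
    then have "?r t \<le> t" using a t by (intro real_le_lsqrt) (auto simp: power_le_one)
    then show "?f t = ?r t ^ d" by simp
  qed
  finally have eq: "cap_integral d = a ^ Suc d / (real d + 1) + integral {a..1} (\<lambda>t. ?r t ^ d)" .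
  have int: "((\<lambda>t. ?r t ^ d) has_integral integral {a..1} (\<lambda>t. ?r t ^ d)) {a..1}"
    by (intro integrable_integral integrable_continuous_real continuous_intros)
  have I: "((\<lambda>t. t * ?r t ^ k) has_integral a ^ (k + 2) / real (k + 2)) {a..1}" for k
    using has_integral_mult_sqrt_power[of a k] a(1,2) unfolding ra by simp
  have s: "sqrt 2 * a ^ (d + 2) = a ^ Suc d" "sqrt 2 * a ^ (d + 4) = a ^ Suc d / 2"
  proof -
    have "sqrt 2 * a ^ (d + 2) = sqrt 2 * a * a ^ Suc d" "sqrt 2 * a ^ (d + 4) = sqrt 2 * a * a\<^sup>2 * a ^ Suc d"
      by (simp_all add: power_add power2_eq_square power4_eq_xxxx)
    then show "sqrt 2 * a ^ (d + 2) = a ^ Suc d" "sqrt 2 * a ^ (d + 4) = a ^ Suc d / 2"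
      unfolding a by simp_all
  qed
  have r0: "0 \<le> ?r t" if "t \<in> {a..1}" for t using that a by (simp add: power_le_one)
  have "integral {a..1} (\<lambda>t. ?r t ^ d) \<le> sqrt 2 * (a ^ (d + 2) / real (d + 2))"
  proof (rule has_integral_le[OF int has_integral_mult_right[OF I]])
    fix t assume t: "t \<in> {a..1}"
    then have "sqrt 2 * a \<le> sqrt 2 * t" by (intro mult_left_mono) auto
    then have "1 * ?r t ^ d \<le> (sqrt 2 * t) * ?r t ^ d"
      using a r0[OF t] by (intro mult_right_mono zero_le_power) auto
    then show "?r t ^ d \<le> sqrt 2 * (t * ?r t ^ d)" by simp
  qed
  also have "\<dots> = a ^ Suc d / (real d + 2)"
    unfolding times_divide_eq_right s by simp
  finally show "cap_integral d \<le> a ^ Suc d * (1 / (real d + 1) + 1 / (real d + 2))"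
    unfolding eq by (simp add: distrib_left)
  have "sqrt 2 / 2 * (a ^ (d + 2) / real (d + 2)) + sqrt 2 * (a ^ (d + 2 + 2) / real (d + 2 + 2)) \<le> integral {a..1} (\<lambda>t. ?r t ^ d)"
  proof (rule has_integral_le[OF has_integral_add[OF has_integral_mult_right[OF I] has_integral_mult_right[OF I]] int])
    fix t assume t: "t \<in> {a..1}"
    then have "t\<^sup>2 \<le> 1" using a by (simp add: power_le_one)
    define u where "u = sqrt 2 * t"
    have u: "u\<^sup>2 = 2 * t\<^sup>2" "0 \<le> u" using t a by (auto simp: u_def power_mult_distrib)
    \<comment> \<open>The tangent inequality in terms of \<open>u = sqrt 2 * t\<close>; the double
      root at \<open>u = 1\<close> is the point of tangency.\<close>
    have "u * (3 - u\<^sup>2) \<le> 2"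
    proof -
      have "0 \<le> (u - 1)\<^sup>2 * (u + 2)" using u by simp
      also have "\<dots> = 2 - u * (3 - u\<^sup>2)" by (simp add: power2_eq_square algebra_simps)
      finally show ?thesis by simp
    qed
    then have "sqrt 2 / 2 * t + sqrt 2 * t * (1 - t\<^sup>2) \<le> 1"
      unfolding u(1) by (simp add: u_def algebra_simps)
    then have "(sqrt 2 / 2 * t + sqrt 2 * t * (1 - t\<^sup>2)) * ?r t ^ d \<le> 1 * ?r t ^ d"
      using r0[OF t] by (intro mult_right_mono zero_le_power) auto
    also have "(sqrt 2 / 2 * t + sqrt 2 * t * (1 - t\<^sup>2)) * ?r t ^ d
      = sqrt 2 / 2 * (t * ?r t ^ d) + sqrt 2 * (t * ((1 - t\<^sup>2) * ?r t ^ d))"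
      by (simp add: distrib_right mult.assoc)
    also have "(1 - t\<^sup>2) * ?r t ^ d = ?r t ^ (d + 2)"
      using \<open>t\<^sup>2 \<le> 1\<close> by (simp add: power_add)
    finally show "sqrt 2 / 2 * (t * ?r t ^ d) + sqrt 2 * (t * ?r t ^ (d + 2)) \<le> ?r t ^ d"
      by (simp add: algebra_simps)
  qed
  also have "sqrt 2 / 2 * (a ^ (d + 2) / real (d + 2)) + sqrt 2 * (a ^ (d + 2 + 2) / real (d + 2 + 2))
     = (sqrt 2 * a ^ (d + 2)) / 2 / (real d + 2) + (sqrt 2 * a ^ (d + 4)) / (real d + 4)"
  proof -
    have "d + 2 + 2 = d + 4" "real (d + 2) = real d + 2" "real (d + 4) = real d + 4" by simp_all
    then show ?thesis by (simp only: times_divide_eq_right times_divide_eq_left mult.assoc divide_divide_eq_left mult.commute[of 2])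
  qed
  also have "\<dots> = a ^ Suc d * (1 / 2 / (real d + 2) + 1 / 2 / (real d + 4))"
    unfolding s by (simp add: distrib_left)
  finally show "a ^ Suc d * (1 / (real d + 1) + 1 / 2 / (real d + 2) + 1 / 2 / (real d + 4)) \<le> cap_integral d"
    unfolding eq by (simp add: distrib_left)
qed

section \<open>Size of the cap for large dimensions\<close>

lemma inverse_sqrt_2_power: "(1 / sqrt 2) ^ Suc d * 2 powr (real d / 2) = 1 / sqrt 2"
proof -
  have "2 powr (real d / 2) = sqrt 2 ^ d"
    by (simp add: powr_half_sqrt[symmetric] powr_powr powr_realpow[symmetric])
  then show ?thesis by (simp add: power_divide)
qed

text \<open>Both bounds are asymptotic to \<open>1 / sqrt (pi * real d)\<close>, so they determine
  the cap to first order.\<close>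

lemma h_quarter_pi_bounds:
  shows "h d (pi / 4) * 2 powr (real d / 2) \<le> sqrt (real d / 2 + 1) / sqrt (2 * pi) * (1 / (real d + 1) + 1 / (real d + 2))"
    and "sqrt ((real d + 1) / 2) / sqrt (2 * pi) * (1 / (real d + 1) + 1 / 2 / (real d + 2) + 1 / 2 / (real d + 4))
      \<le> h d (pi / 4) * 2 powr (real d / 2)"
proof -
  let ?a = "1 / sqrt 2 :: real" and ?q = "unit_ball_vol (real d) / unit_ball_vol (real (Suc d))"
  have q: "0 \<le> ?q" by (intro divide_nonneg_nonneg unit_ball_vol_nonneg) auto
  have eq: "A / sqrt pi * (?a ^ Suc d * B) * 2 powr (real d / 2) = A / sqrt (2 * pi) * B" for A B
  proof -
    have "A / sqrt pi * (?a ^ Suc d * B) * 2 powr (real d / 2) = A / sqrt pi * B * (?a ^ Suc d * 2 powr (real d / 2))"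
      by (simp only: mult_ac)
    also have "\<dots> = A / sqrt (2 * pi) * B"
      unfolding inverse_sqrt_2_power by (simp add: real_sqrt_mult)
    finally show ?thesis .
  qed
  let ?L = "?a ^ Suc d * (1 / (real d + 1) + 1 / 2 / (real d + 2) + 1 / 2 / (real d + 4))"
  have L: "0 \<le> ?L" by (intro mult_nonneg_nonneg add_nonneg_nonneg zero_le_power) auto
  have "?q * cap_integral d \<le> sqrt (real d / 2 + 1) / sqrt pi * (?a ^ Suc d * (1 / (real d + 1) + 1 / (real d + 2)))"
    using L by (intro mult_mono unit_ball_vol_ratio_bounds cap_integral_bounds order_trans[OF L cap_integral_bounds(2)]) auto
  then show "h d (pi / 4) * 2 powr (real d / 2) \<le> sqrt (real d / 2 + 1) / sqrt (2 * pi) * (1 / (real d + 1) + 1 / (real d + 2))"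
    unfolding h_quarter_pi_eq eq[symmetric] by (intro mult_right_mono) auto
  have "sqrt ((real d + 1) / 2) / sqrt pi * ?L \<le> ?q * cap_integral d"
    using L q by (intro mult_mono unit_ball_vol_ratio_bounds cap_integral_bounds) auto
  then show "sqrt ((real d + 1) / 2) / sqrt (2 * pi) * (1 / (real d + 1) + 1 / 2 / (real d + 2) + 1 / 2 / (real d + 4))
      \<le> h d (pi / 4) * 2 powr (real d / 2)"
    unfolding h_quarter_pi_eq eq[symmetric] by (intro mult_right_mono) auto
qed

lemma h_quarter_pi_pos: "0 < h d (pi / 4)"
proof -
  have "0 < sqrt ((real d + 1) / 2) / sqrt (2 * pi) * (1 / (real d + 1) + 1 / 2 / (real d + 2) + 1 / 2 / (real d + 4))"
    by (intro mult_pos_pos divide_pos_pos) (auto intro!: add_pos_nonneg)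
  also note h_quarter_pi_bounds(2)
  finally show ?thesis by (simp add: zero_less_mult_iff)
qed

text \<open>Replacing the square root by its argument costs a power of \<open>d\<close>, but bounds
  \<open>h d (pi / 4) * 2 powr (real d / 2)\<close> by 2 for all \<open>d\<close> at once, whence
  the constant 1/4.\<close>

lemma inverse_h_ge: "inverse (2 * h d (pi / 4)) \<ge> 1/4 * 2 powr (real d / 2)"
proof -
  have "sqrt (real d / 2 + 1) / sqrt (2 * pi) \<le> (real d / 2 + 1) / 1"
  proof (intro frac_le)
    show "sqrt (real d / 2 + 1) \<le> real d / 2 + 1" by (rule real_le_lsqrt) (auto simp: power2_eq_square algebra_simps)
    show "1 \<le> sqrt (2 * pi)" using pi_gt3 by simp
  qed auto
  then have "sqrt (real d / 2 + 1) / sqrt (2 * pi) * (1 / (real d + 1) + 1 / (real d + 2))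
    \<le> (real d / 2 + 1) / 1 * (1 / (real d + 1) + 1 / (real d + 2))"
    by (intro mult_right_mono) auto
  also have "\<dots> = (real d / 2 + 1) / (real d + 1) + (real d / 2 + 1) / (real d + 2)"
    by (simp add: distrib_left)
  also have "(real d / 2 + 1) / (real d + 1) \<le> 1" by (simp add: field_simps)
  also have "(real d / 2 + 1) / (real d + 2) \<le> 1" by (simp add: field_simps)
  finally have "h d (pi / 4) * 2 powr (real d / 2) \<le> 2"
    using h_quarter_pi_bounds(1)[of d] by linarith
  then show ?thesis using h_quarter_pi_pos[of d] by (simp add: field_simps)
qed

lemma inverse_h_asymp_equiv:
  "(\<lambda>d. inverse (h d (pi / 4))) \<sim>[sequentially] (\<lambda>d. sqrt pi * sqrt (real d) * 2 powr (real d / 2))"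
proof (rule asymp_equivI')
  have "(\<lambda>d. h d (pi / 4) * 2 powr (real d / 2) * (sqrt pi * sqrt (real d))) \<longlonglongrightarrow> 1"
  proof (rule tendsto_sandwich)
    let ?L = "\<lambda>d. sqrt ((real d + 1) / 2) / sqrt (2 * pi) * (1 / (real d + 1) + 1 / 2 / (real d + 2) + 1 / 2 / (real d + 4)) * (sqrt pi * sqrt (real d))"
    let ?U = "\<lambda>d. sqrt (real d / 2 + 1) / sqrt (2 * pi) * (1 / (real d + 1) + 1 / (real d + 2)) * (sqrt pi * sqrt (real d))"
    show "\<forall>\<^sub>F d in sequentially. ?L d \<le> h d (pi / 4) * 2 powr (real d / 2) * (sqrt pi * sqrt (real d))"
      by (intro always_eventually allI mult_right_mono h_quarter_pi_bounds) auto
    show "\<forall>\<^sub>F d in sequentially. h d (pi / 4) * 2 powr (real d / 2) * (sqrt pi * sqrt (real d)) \<le> ?U d"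
      by (intro always_eventually allI mult_right_mono h_quarter_pi_bounds) auto
    \<comment> \<open>Cancelling \<open>pi\<close> beforehand leaves algebraic limits only.\<close>
    have eq: "sqrt (A / 2) / sqrt (2 * pi) * B * (sqrt pi * C) = sqrt A / 2 * B * C" for A B C :: real
      by (simp add: real_sqrt_mult real_sqrt_divide)
    have half: "real d / 2 + 1 = (real d + 2) / 2" for d by simp
    show "?L \<longlonglongrightarrow> 1" unfolding eq by real_asymp
    show "?U \<longlonglongrightarrow> 1" unfolding half eq by real_asymp
  qed
  then have "(\<lambda>d. inverse (h d (pi / 4) * 2 powr (real d / 2) * (sqrt pi * sqrt (real d)))) \<longlonglongrightarrow> inverse 1"
    by (rule tendsto_inverse) simp
  then show "(\<lambda>d. inverse (h d (pi / 4)) / (sqrt pi * sqrt (real d) * 2 powr (real d / 2))) \<longlonglongrightarrow> 1"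
    by (simp add: field_simps)
qed

subsection \<open>Families avoiding hyperplanes\<close>

lemma vol_uminus_image:
  fixes S :: "(real ^ 'm::{finite,wellorder}) set"
  assumes "S \<in> sets borel"
  shows "vol (uminus ` S) = vol S"
proof -
  have "uminus ` S \<inter> cball 0 1 = uminus ` (S \<inter> cball 0 1)" by auto
  moreover have "orthogonal_transformation (\<lambda>x :: real ^ 'm::_. - x)"
    by (simp add: orthogonal_transformation_neg)
  ultimately show ?thesis
    unfolding vol_def by (simp add: measure_orthogonal_image lmeasurable_Int_cball[OF assms])
qed

text \<open>The affine hyperplane is the trace on the slice of the linear one with normal
  \<open>join b w\<close>. The interior of \<open>K\<close> is connected and misses it, hence lies
  on one side; scaling by the positive coordinate \<open>x $ coord0\<close> carries the sign over to
  the cone.\<close>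

lemma hyperplane_avoids_polar:
  fixes K :: "(real ^ 'n::finite) set"
  assumes K: "convex K" and avoids: "avoids {x. w \<bullet> x = - b} K"
  shows "(\<forall>x\<in>cone_over (interior K). x \<bullet> join b w \<le> 0) \<or> (\<forall>x\<in>cone_over (interior K). 0 \<le> x \<bullet> join b w)"
proof -
  have ne: "w \<bullet> x \<noteq> - b" if "x \<in> interior K" for x
    using avoids that by (auto simp: avoids_def)
  have conn: "connected (interior K)"
    using K by (intro convex_connected convex_interior)
  have "(\<forall>x\<in>interior K. w \<bullet> x \<le> - b) \<or> (\<forall>x\<in>interior K. - b \<le> w \<bullet> x)"
    using connected_ivt_hyperplane[OF conn, of _ _ w "- b"] ne by (meson linear)
  moreover have "x \<bullet> join b w = x $ coord0 * (b + w \<bullet> (\<chi> j. x $ coord j / x $ coord0))"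
    if "x \<in> cone_over (interior K)" for x
  proof -
    have "0 < x $ coord0" using that by (simp add: cone_over_def)
    then show ?thesis
      by (simp add: inner_vec_def sum_upto_card distrib_left sum_distrib_left mult.commute)
  qed
  moreover have "0 < x $ coord0" "(\<chi> j. x $ coord j / x $ coord0) \<in> interior K"
    if "x \<in> cone_over (interior K)" for x
    using that by (auto simp: cone_over_def)
  ultimately show ?thesis
    by (auto simp: mult_le_0_iff zero_le_mult_iff not_less; smt (verit))
qed

text \<open>
  Every hyperplane avoiding \<open>A i\<close> corresponds to a normal direction in the polar cone of the cone
  over \<open>A i\<close>, or in its negative; so these cones cover the whole space, while each of them has at
  most the volume of the circular one.
\<close>

lemma hyperplane_avoiding_family_bound:
  fixes A :: "'i \<Rightarrow> (real ^ 'n::finite) set"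
  assumes I: "finite I" and convex: "\<And>i. i \<in> I \<Longrightarrow> convex (A i)"
    and \<alpha>: "\<And>i. i \<in> I \<Longrightarrow> \<alpha> \<le> measure central_measure (A i)"
    and avoid: "\<And>H. hyperplane H \<Longrightarrow> \<exists>i\<in>I. avoids H (A i)"
    and card: "real (card I) * \<alpha> \<le> 1"
  shows "\<alpha> \<le> 2 * h CARD('n) (pi / 4)"
proof (rule ccontr)
  let ?e = "axis coord0 1 :: real ^ 'n upto_card" and ?V = "vol (UNIV :: (real ^ 'n upto_card) set)"
  let ?C = "quarter_cone ?e"
  have V: "0 < ?V" by (rule vol_UNIV_pos)
  assume "\<not> \<alpha> \<le> 2 * h CARD('n) (pi / 4)"
  then have less: "2 * vol ?C < \<alpha> * ?V"
    using V by (simp add: h_card_eq_vol field_simps)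
  define U where "U = (\<lambda>i. cone_over (interior (A i)))"
  define P where "P = (\<lambda>i. {y. \<forall>x\<in>U i. x \<bullet> y \<le> 0})"
  have U: "U i \<in> sets borel" "pos_cone (U i)" for i
    by (auto simp: U_def pos_cone_cone_over intro!: borel_cone_over)
  have P: "P i \<in> sets borel" for i
  proof -
    have "P i = (\<Inter>x\<in>U i. {y. x \<bullet> y \<le> 0})" by (auto simp: P_def)
    then show ?thesis by (auto intro!: borel_closed closed_INT closed_halfspace_le)
  qed
  have uP: "uminus ` P i \<in> sets borel" for i
  proof -
    have "uminus ` P i = (\<lambda>y. - y) -` P i" by (auto intro: image_eqI[of _ _ "- _"])
    also have "\<dots> \<in> sets borel" using P by (intro measurable_sets_borel[of _ borel]) auto
    finally show ?thesis .
  qed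
  have vol_P: "vol (P i) \<le> vol ?C" if "i \<in> I" for i
  proof (rule vol_polar_pair[of "U i"])
    show "pos_cone (P i)"
      by (auto simp: P_def pos_cone_def mult_le_0_iff)
    have "\<alpha> \<le> 2 * vol (U i) / ?V"
      using \<alpha>[OF that] measure_central_measure_le[OF convex[OF that]] by (simp add: U_def)
    then have "\<alpha> * ?V \<le> 2 * vol (U i)" using V by (simp add: field_simps)
    then show "vol ?C < vol (U i)" using less by simp
  qed (use U P in \<open>auto simp: P_def\<close>)
  \<comment> \<open>Normals with \<open>w = 0\<close> belong to no hyperplane of
    \<open>real ^ 'n\<close>. They form a line, which is null since the dimension is at least
    2.\<close>
  define W where "W = {y :: real ^ 'n upto_card. \<forall>j. y $ coord j = 0}"
  have W0: "negligible (W \<inter> cball 0 1)"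
  proof (rule negligible_subset)
    show "negligible {y. (axis (coord undefined) 1 :: real ^ 'n upto_card) \<bullet> y = 0}"
      by (rule negligible_hyperplane) (simp add: axis_eq_0_iff)
    show "W \<inter> cball 0 1 \<subseteq> {y. (axis (coord undefined) 1 :: real ^ 'n upto_card) \<bullet> y = 0}"
      by (auto simp: W_def inner_axis')
  qed
  have "UNIV = W \<union> (\<Union>i\<in>I. P i \<union> uminus ` P i)"
  proof -
    have "y \<in> (\<Union>i\<in>I. P i \<union> uminus ` P i)" if y: "y \<notin> W" for y
    proof -
      define b w where "b = y $ coord0" and "w = (\<chi> j. y $ coord j)"
      have yj: "y = join b w" by (simp add: b_def w_def join_surj)
      have "w \<noteq> 0" using y by (auto simp: W_def w_def vec_eq_iff)
      then have "hyperplane {x. w \<bullet> x = - b}" by (auto simp: hyperplane_def)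
      then obtain i where i: "i \<in> I" "avoids {x. w \<bullet> x = - b} (A i)" using avoid by blast
      have "y \<in> P i \<or> - y \<in> P i"
        using hyperplane_avoids_polar[OF convex[OF i(1)] i(2)] unfolding P_def U_def yj by simp
      then have "y \<in> P i \<union> uminus ` P i" by (auto intro: image_eqI[of _ _ "- y"])
      then show ?thesis using i(1) by blast
    qed
    then show ?thesis by blast
  qed
  then have "?V = vol (W \<union> (\<Union>i\<in>I. P i \<union> uminus ` P i))" by (rule arg_cong)
  also have "\<dots> = measure lebesgue ((W \<inter> cball 0 1) \<union> (\<Union>i\<in>I. (P i \<inter> cball 0 1) \<union> (uminus ` P i \<inter> cball 0 1)))"
  proof -
    have "(W \<union> (\<Union>i\<in>I. P i \<union> Q i)) \<inter> B = (W \<inter> B) \<union> (\<Union>i\<in>I. (P i \<inter> B) \<union> (Q i \<inter> B))" for Q B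
      by blast
    then show ?thesis unfolding vol_def by (rule arg_cong)
  qed
  also have "\<dots> \<le> measure lebesgue (W \<inter> cball 0 1) + (\<Sum>i\<in>I. vol (P i) + vol (uminus ` P i))"
  proof -
    have W: "W \<inter> cball 0 1 \<in> lmeasurable"
      by (rule negligible_imp_measurable[OF W0])
    have PP: "P i \<inter> cball 0 1 \<in> lmeasurable" "uminus ` P i \<inter> cball 0 1 \<in> lmeasurable" for i
      using P uP by (auto intro: lmeasurable_Int_cball)
    have "measure lebesgue (\<Union>i\<in>I. (P i \<inter> cball 0 1) \<union> (uminus ` P i \<inter> cball 0 1))
      \<le> (\<Sum>i\<in>I. measure lebesgue ((P i \<inter> cball 0 1) \<union> (uminus ` P i \<inter> cball 0 1)))"
      using I PP by (intro measure_UNION_le) (auto intro: fmeasurableD)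
    also have "\<dots> \<le> (\<Sum>i\<in>I. vol (P i) + vol (uminus ` P i))"
      unfolding vol_def using PP by (intro sum_mono measure_Un_le) (auto intro: fmeasurableD)
    finally have "measure lebesgue (\<Union>i\<in>I. (P i \<inter> cball 0 1) \<union> (uminus ` P i \<inter> cball 0 1))
      \<le> (\<Sum>i\<in>I. vol (P i) + vol (uminus ` P i))" .
    moreover have "measure lebesgue ((W \<inter> cball 0 1) \<union> (\<Union>i\<in>I. (P i \<inter> cball 0 1) \<union> (uminus ` P i \<inter> cball 0 1)))
      \<le> measure lebesgue (W \<inter> cball 0 1) + measure lebesgue (\<Union>i\<in>I. (P i \<inter> cball 0 1) \<union> (uminus ` P i \<inter> cball 0 1))"
      using I W PP by (intro measure_Un_le sets.finite_UN sets.Un) (auto intro: fmeasurableD)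
    ultimately show ?thesis by linarith
  qed
  also have "measure lebesgue (W \<inter> cball 0 1) = 0"
    by (rule negligible_imp_measure0[OF W0])
  also have "(\<Sum>i\<in>I. vol (P i) + vol (uminus ` P i)) = (\<Sum>i\<in>I. 2 * vol (P i))"
    using P by (simp add: vol_uminus_image)
  also have "\<dots> \<le> (\<Sum>i\<in>I. 2 * vol ?C)"
    using vol_P by (intro sum_mono) auto
  finally have VC: "?V \<le> real (card I) * (2 * vol ?C)" by simp
  \<comment> \<open>A nonempty index set makes the next inequality strict.\<close>
  then have "card I \<noteq> 0" using V by (cases "card I = 0") auto
  then have "real (card I) * (2 * vol ?C) < real (card I) * (\<alpha> * ?V)"
    using less by (intro mult_strict_left_mono) auto
  also have "\<dots> \<le> 1 * ?V"
    using mult_right_mono[OF card, of ?V] V by (simp add: mult.assoc)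
  finally show False using VC by simp
qed

text \<open>The bound has \<open>2 * h\<close> because the open hemisphere, of measure 1/2, is
  rescaled to a probability measure. In the last claim \<open>sqrt (real d)\<close> is part of the
  exact order of growth, so the purely exponential expression before it is a lower bound
  only.\<close>

theorem theorem5:
  fixes \<alpha> :: real
  assumes "\<alpha> > 0"
  shows
    "((\<forall>\<mu> :: (real ^ 'n) measure. nice_measure \<mu> \<longrightarrow>
         (\<exists>A :: (real ^ 'n) set set.
            (\<forall>K\<in>A. convex K) \<and>
            (\<forall>K\<in>A. \<alpha> \<le> measure \<mu> K) \<and>
            (\<forall>H. hyperplane H \<longrightarrow> (\<exists>K\<in>A. avoids H K)) \<and>
            (\<Sum>\<^sub>\<infinity>K\<in>A. emeasure \<mu> K) \<le> 1))
       \<longrightarrow> 1 / \<alpha> \<ge> inverse (2 * h CARD('n) (pi / 4)))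
     \<and> (1 \<ge> ereal \<alpha> * ereal_of_enat (M_number TYPE(real ^ 'n) 1 \<alpha>)
       \<longrightarrow> 1 / \<alpha> \<ge> inverse (2 * h CARD('n) (pi / 4)))
     \<and> (\<exists>C>0. \<forall>d\<ge>1. inverse (2 * h d (pi / 4)) \<ge> C * 2 powr (real d / 2))
     \<and> (\<exists>C>0. (\<lambda>d. inverse (h d (pi / 4))) \<sim>[sequentially]
                 (\<lambda>d. C * sqrt (real d) * 2 powr (real d / 2)))"
proof (intro conjI impI)
  have le: "1 / \<alpha> \<ge> inverse (2 * h CARD('n) (pi / 4))" if "\<alpha> \<le> 2 * h CARD('n) (pi / 4)"
    using le_imp_inverse_le[OF that assms] by (simp add: inverse_eq_divide)
  {
    assume *: "\<forall>\<mu> :: (real ^ 'n) measure. nice_measure \<mu> \<longrightarrow>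
         (\<exists>A :: (real ^ 'n) set set.
            (\<forall>K\<in>A. convex K) \<and>
            (\<forall>K\<in>A. \<alpha> \<le> measure \<mu> K) \<and>
            (\<forall>H. hyperplane H \<longrightarrow> (\<exists>K\<in>A. avoids H K)) \<and>
            (\<Sum>\<^sub>\<infinity>K\<in>A. emeasure \<mu> K) \<le> 1)"
    obtain A :: "(real ^ 'n) set set" where A: "\<And>K. K \<in> A \<Longrightarrow> convex K"
      "\<And>K. K \<in> A \<Longrightarrow> \<alpha> \<le> measure central_measure K"
      "\<And>H. hyperplane H \<Longrightarrow> \<exists>K\<in>A. avoids H K"
      and sum: "(\<Sum>\<^sub>\<infinity>K\<in>A. emeasure central_measure K) \<le> 1"
      using *[rule_format, OF nice_central_measure] by auto
    have ge: "ennreal \<alpha> \<le> emeasure central_measure K" if "K \<in> A" for K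
    proof -
      have "ennreal \<alpha> \<le> ennreal (measure central_measure K)" using A(2)[OF that] by (rule ennreal_leI)
      also have "\<dots> \<le> emeasure central_measure K" by (simp add: measure_def ennreal_enn2real_if)
      finally show ?thesis .
    qed
    have "finite A"
    proof (rule ccontr)
      assume "infinite A"
      then have "(\<Sum>\<^sub>\<infinity>K\<in>A. emeasure central_measure K) = \<infinity>"
        using ge assms by (intro infsum_superconst_infinite_ennreal[of A "ennreal \<alpha>"]) auto
      then show False using sum by (simp add: top_unique)
    qed
    have "ennreal (real (card A) * \<alpha>) = (\<Sum>K\<in>A. ennreal \<alpha>)"
      using assms by (simp add: ennreal_mult ennreal_of_nat_eq_real_of_nat)
    also have "\<dots> \<le> (\<Sum>K\<in>A. emeasure central_measure K)" using ge by (rule sum_mono)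
    also have "\<dots> \<le> 1" using sum \<open>finite A\<close> by simp
    finally have "real (card A) * \<alpha> \<le> 1" by (simp add: ennreal_le_1)
    then have "\<alpha> \<le> 2 * h CARD('n) (pi / 4)"
      using A \<open>finite A\<close> by (intro hyperplane_avoiding_family_bound[of A "\<lambda>K. K"]) auto
    then show "1 / \<alpha> \<ge> inverse (2 * h CARD('n) (pi / 4))" by (rule le)
  next
    assume M: "1 \<ge> ereal \<alpha> * ereal_of_enat (M_number TYPE(real ^ 'n) 1 \<alpha>)"
    let ?S = "{enat m | m. 0 < m \<and>
       (\<forall>\<mu> :: (real ^ 'n) measure. nice_measure \<mu> \<longrightarrow>
          (\<exists>A :: nat \<Rightarrow> (real ^ 'n) set.
             (\<forall>i<m. convex (A i) \<and> \<alpha> \<le> measure \<mu> (A i)) \<and>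
             (\<forall>H. hyperplane H \<longrightarrow> 1 \<le> card {i. i < m \<and> avoids H (A i)})))}"
    have eq: "M_number TYPE(real ^ 'n) 1 \<alpha> = Inf ?S" by (simp only: M_number_def)
    \<comment> \<open>If no number of sets sufficed, \<open>M_number\<close> would be infinite, and
      so would its product with the positive \<open>\<alpha>\<close>. Hence the infimum is attained,
      by well-ordering.\<close>
    have "?S \<noteq> {}"
    proof
      assume "?S = {}"
      then have "M_number TYPE(real ^ 'n) 1 \<alpha> = \<infinity>" unfolding eq by (simp only: Inf_empty top_enat_def)
      then show False using M assms by simp
    qed
    then have "M_number TYPE(real ^ 'n) 1 \<alpha> \<in> ?S"
      unfolding eq by (meson ex_in_conv wellorder_InfI)
    then obtain m where m: "M_number TYPE(real ^ 'n) 1 \<alpha> = enat m"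
      and *: "\<forall>\<mu> :: (real ^ 'n) measure. nice_measure \<mu> \<longrightarrow>
          (\<exists>A :: nat \<Rightarrow> (real ^ 'n) set.
             (\<forall>i<m. convex (A i) \<and> \<alpha> \<le> measure \<mu> (A i)) \<and>
             (\<forall>H. hyperplane H \<longrightarrow> 1 \<le> card {i. i < m \<and> avoids H (A i)}))"
      unfolding mem_Collect_eq by (elim exE conjE) (rule that)
    have "\<exists>A :: nat \<Rightarrow> (real ^ 'n) set.
             (\<forall>i<m. convex (A i) \<and> \<alpha> \<le> measure central_measure (A i)) \<and>
             (\<forall>H. hyperplane H \<longrightarrow> 1 \<le> card {i. i < m \<and> avoids H (A i)})"
      using *[rule_format, OF nice_central_measure] .
    then obtain A :: "nat \<Rightarrow> (real ^ 'n) set" where A: "\<And>i. i < m \<Longrightarrow> convex (A i)"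
      "\<And>i. i < m \<Longrightarrow> \<alpha> \<le> measure central_measure (A i)"
      "\<And>H. hyperplane H \<Longrightarrow> 1 \<le> card {i. i < m \<and> avoids H (A i)}"
      by blast
    have "\<exists>i\<in>{..<m}. avoids H (A i)" if "hyperplane H" for H
    proof -
      have "{i. i < m \<and> avoids H (A i)} \<noteq> {}" using A(3)[OF that] by (auto simp del: Collect_empty_eq)
      then show ?thesis by blast
    qed
    moreover have "real (card {..<m}) * \<alpha> \<le> 1"
      using M unfolding m by (simp add: mult.commute)
    ultimately have "\<alpha> \<le> 2 * h CARD('n) (pi / 4)"
      using A by (intro hyperplane_avoiding_family_bound[of "{..<m}" A]) auto
    then show "1 / \<alpha> \<ge> inverse (2 * h CARD('n) (pi / 4))" by (rule le)
  }
  show "\<exists>C>0. \<forall>d\<ge>1. inverse (2 * h d (pi / 4)) \<ge> C * 2 powr (real d / 2)"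
    using inverse_h_ge by (intro exI[of _ "1/4"]) auto
  show "\<exists>C>0. (\<lambda>d. inverse (h d (pi / 4))) \<sim>[sequentially] (\<lambda>d. C * sqrt (real d) * 2 powr (real d / 2))"
    using inverse_h_asymp_equiv by (intro exI[of _ "sqrt pi"]) auto
qed

end
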